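(* Assume that $\tau_\diamond(I^\ast)$ is well defined and that there exists $\alpha\in(0,1)$ such that $$\big\|\Gamma_{2,1}^\ast(\Gamma_{1,1}^\ast)^{+}D f_{I^\ast}\big\|_\circ\le (1-\alpha)\,\tau_\diamond(I^\ast).$$ Suppose that for some $(r,\lambda)\in(0,1)\times(0,\infty)$ we have $r\le \eta\,\zeta_\diamond(K^\ast)$ and $$\|\mathrm{vec}(\hat\Sigma-\Sigma^\ast)\|_\circ\le \min\left\{\frac{r}{\eta\,\|Q\|_{\circ,\mathrm{op}}}-\lambda c_\diamond,\ \frac{\alpha\,\lambda\,\tau_\diamond(I^\ast)}{\|I_{p^2}-Q\|_{\circ,\mathrm{op}}}\right\}-\frac1\eta\,\frac{r^2}{1-r}.$$ Let $\hat K$ be the unique solution of $$\hat K=\arg\min_{K\in\mathrm{Sym}_+(p)}\left\{\mathrm{tr}(\hat\Sigma K)-\log\det(K)+\lambda\,\mathrm{pen}(K)\right\}.$$ Then $\mathrm{patt}_\diamond(\hat K)=\mathrm{patt}_\diamond(K^\ast)$ and $$\|\Gamma^\ast\mathrm{vec}(\hat K-K^\ast)\|_\circ\le \frac r\eta .$$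
   Context: Matrices. Let $p\ge 2$, $m=p(p-1)/2$. $\mathrm{Sym}(p)$ is the space of real symmetric $p\times p$ matrices, $\mathrm{Sym}_+(p)$ the positive definite ones, $\mathrm{Sym}_0(p)$ those with zero diagonal. $\mathrm{vec}(X)\in\mathbb R^{p^2}$ stacks the columns of $X$; $\mathrm{vec}_+(X)\in\mathbb R^m$ stacks the strictly lower triangular entries (diagonal excluded). The duplication matrix $D$ is defined by $D\,\mathrm{vec}_+(X)=\mathrm{vec}(X)$ for all $X\in\mathrm{Sym}_0(p)$. $A^+$ is the Moore–Penrose inverse. Atomic norm. $\|x\|_\diamond=\max\{v_1^\top x,\dots,v_N^\top x\}$ on $\mathbb R^m$, where $0$ is in the interior of $\mathrm{conv}\{v_1,\dots,v_N\}$ and no $v_i$ is redundant (for each $i$ there is $x$ with $\max_{j\ne i}v_j^\top x\ne\|x\|_\diamond$). Symmetry $\|-x\|_\diamond=\|x\|_\diamond$ is not required. The dual gauge is $\|y\|_\diamond^\ast=\sup\{x^\top y:\|x\|_\diamond\le1\}$. For $x\in\mathbb R^m$ let $I_x=\{i: v_i^\top x=\|x\|_\diamond\}$; the subdifferential is $\partial\|x\|_\diamond=\mathrm{conv}\{v_i:i\in I_x\}$. We write $\mathrm{patt}_\diamond(x)=\mathrm{patt}_\diamond(y)$ if $\partial\|x\|_\diamond=\partial\|y\|_\diamond$, and for $X\in\mathrm{Sym}(p)$ we write $\mathrm{patt}_\diamond(X)$ for $\mathrm{patt}_\diamond(\mathrm{vec}_+(X))$. For $I=I_x$ the pattern subspace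 is $S_I=\{y\in\mathbb R^m: v_i^\top y=v_j^\top y\ \forall i,j\in I\}$ (the span of $\{y:I_y=I\}$), $P_I$ is the orthogonal projection onto $S_I$, and the face projection is $f_I=P_Iv_{i_0}$ for any $i_0\in I$ (it does not depend on $i_0$). The restricted dual gauge is $\|y\|^\ast_{\diamond|I}=\sup\{x^\top y:x\in S_I,\|x\|_\diamond\le1\}$ for $y\in S_I$. The penalty is $\mathrm{pen}(K)=2\|\mathrm{vec}_+(K)\|_\diamond$. Model. $X$ is a zero-mean random vector in $\mathbb R^p$ with finite second moments and positive definite covariance $\Sigma^\ast$; $K^\ast=(\Sigma^\ast)^{-1}$; $\hat\Sigma=\frac1n\sum_{i=1}^nX^{(i)}(X^{(i)})^\top$ for i.i.d. copies $X^{(i)}$ of $X$. The statement is pointwise, for any realization of $\hat\Sigma$ satisfying the displayed inequality. Put $I^\ast=I_{\mathrm{vec}_+(K^\ast)}$, $S^\ast=S_{I^\ast}$, $\mathcal M^\ast=\{K\in\mathrm{Sym}(p):\mathrm{vec}_+(K)\in S^\ast\}$, $\Gamma^\ast=\Sigma^\ast\otimes\Sigma^\ast$, and let $P_{\mathcal M^\ast}\in\mathrm{Sym}(p^2)$ be the orthogonal projection matrix onto $\mathrm{vec}(\mathcal M^\ast)$. Let $\Gamma^\ast_{1,1}=P_{\mathcal M^\ast}\Gamma^\ast P_{\mathcal M^\ast}$, $\Gamma^\ast_{2,1}=(I_{p^2}-P_{\mathcal M^\ast})\Gamma^\ast P_{\mathcal M^\ast}$, $Q=\Gamma^\ast(\Gamma^\ast_{1,1})^+$.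 Norms and constants. $\|\cdot\|_\circ$ is an arbitrary fixed norm on $\mathbb R^{p^2}$ and $\|\cdot\|_{\circ,\mathrm{op}}$ its induced operator norm. $\tau_\diamond(I)=\sup\{t\ge0:\ \forall \pi\in S_I^\perp,\ \|D\pi\|_\circ\le t\Rightarrow\|f_I+\pi\|_\diamond^\ast\le1\}\in[0,\infty]$, which is well defined iff this set is non-empty. $\zeta_\diamond(K^\ast)=\sup\{z>0:\ \forall K\in\mathcal M^\ast,\ \|\Gamma^\ast\mathrm{vec}(K-K^\ast)\|_\circ\le z\Rightarrow\mathrm{patt}_\diamond(K)=\mathrm{patt}_\diamond(K^\ast)\}\in(0,\infty]$. $c_\diamond\ge0$ is a constant with $\|D\pi\|_\circ\le c_\diamond\|\pi\|^\ast_{\diamond|I^\ast}$ for all $\pi\in S^\ast$, and $\eta>0$ is a constant with $\|\Sigma^\ast\Delta\otimes I_p\|_{\circ,\mathrm{op}}\le\eta\,\|\Gamma^\ast\mathrm{vec}(\Delta)\|_\circ$ for all $\Delta\in\mathcal M^\ast$. *)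

theory Defs
  imports "HOL-Probability.Probability"
begin

section \<open>Matrices\<close>

text \<open>
  The index type \<open>'p\<close> of \<open>p \<times> p\<close> matrices is linearly ordered, so that "lower triangular" makes
  sense, and has class \<^class>\<open>card2\<close>, i.e. \<open>p = CARD('p) \<ge> 2\<close>.
\<close>

type_synonym 'p sqmat = "((real, 'p) vec, 'p) vec"

definition Sym :: "(real^'n^'n) set" where
  "Sym = {A. transpose A = A}"

definition Sym_pos :: "(real^'n^'n) set" where
  "Sym_pos = {A \<in> Sym. \<forall>x. x \<noteq> 0 \<longrightarrow> 0 < x \<bullet> (A *v x)}"

definition Sym_zero :: "(real^'n^'n) set" where
  "Sym_zero = {A \<in> Sym. \<forall>i. A $ i $ i = 0}"

text \<open>
  Coordinates of \<open>\<real>\<^sup>p\<^sup>2\<close> are pairs (column, row), in this order, so that the lexicographic order of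
  the index pairs is the order in which the columns are stacked, and \<open>kron A B\<close> below is the usual
  Kronecker product, with \<open>kron A B *v vec_col X = vec_col (B ** X ** transpose A)\<close>.
\<close>

definition vec_col :: "real^'n^'n \<Rightarrow> real^('n \<times> 'n)" where
  "vec_col X = (\<chi> k. X $ snd k $ fst k)"

definition kron :: "real^'a^'b \<Rightarrow> real^'c^'d \<Rightarrow> real^('a \<times> 'c)^('b \<times> 'd)" where
  "kron A B = (\<chi> i j. A $ fst i $ fst j * B $ snd i $ snd j)"

text \<open>
  The \<open>m = p (p - 1) / 2\<close> strictly lower triangular positions, again as pairs (column, row); so
  \<open>\<real>\<^sup>m\<close> is the type \<open>real^'p lower\<close>.
\<close>

typedef (overloaded) ('p::"{card2,linorder}") lower = "{(j::'p, i::'p). j < i}"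
proof -
  have "1 < CARD('p)"
    using two_le_card[where 'a='p] by linarith
  then have "\<not> card (UNIV :: 'p set) \<le> Suc 0" by simp
  then obtain a b :: 'p where "a \<noteq> b"
    using card_le_Suc0_iff_eq[of "UNIV :: 'p set"] by auto
  then have "(min a b, max a b) \<in> {(j, i). j < i}"
    by (auto simp: min_def max_def)
  then show ?thesis by blast
qed

instance lower :: ("{card2,linorder}") finite
proof
  have "(UNIV :: 'a lower set) = Abs_lower ` {(j, i). j < i}"
    by (metis type_definition.Abs_image type_definition_lower)
  then show "finite (UNIV :: 'a lower set)"
    by (metis finite finite_imageI)
qed

definition vec_low :: "'p::{card2,linorder} sqmat \<Rightarrow> real^'p lower" where
  "vec_low X = (\<chi> k. X $ snd (Rep_lower k) $ fst (Rep_lower k))"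

definition dup :: "real^('p::{card2,linorder}) lower^('p \<times> 'p)" where
  "dup = (THE D. \<forall>X \<in> Sym_zero. D *v vec_low X = vec_col X)"

text \<open>The Moore--Penrose inverse, given by the four Penrose equations.\<close>

definition pinv :: "real^'n^'m \<Rightarrow> real^'m^'n" where
  "pinv A = (THE B. A ** B ** A = A \<and> B ** A ** B = B \<and>
     transpose (A ** B) = A ** B \<and> transpose (B ** A) = B ** A)"

definition proj_matrix :: "(real^'n) set \<Rightarrow> real^'n^'n" where
  "proj_matrix S = (THE P. \<forall>x. P *v x \<in> S \<and> x - P *v x \<in> orthogonal_comp S)"


section \<open>Norms on \<open>\<real>\<^sup>n\<close>\<close>

definition is_norm :: "('a::real_vector \<Rightarrow> real) \<Rightarrow> bool" where
  "is_norm \<nu> \<longleftrightarrow> (\<forall>x. 0 \<le> \<nu> x) \<and> (\<forall>x. \<nu> x = 0 \<longleftrightarrow> x = 0) \<and>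
     (\<forall>a x. \<nu> (a *\<^sub>R x) = \<bar>a\<bar> * \<nu> x) \<and> (\<forall>x y. \<nu> (x + y) \<le> \<nu> x + \<nu> y)"

definition op_norm :: "(real^'n \<Rightarrow> real) \<Rightarrow> real^'n^'n \<Rightarrow> real" where
  "op_norm \<nu> A = Sup {\<nu> (A *v x) |x. \<nu> x \<le> 1}"


section \<open>Atomic norms\<close>

text \<open>
  The atoms are \<open>v 1, \<dots>, v N\<close>. If \<open>atoms N v\<close> holds then \<open>N \<ge> 2\<close>, since the origin is interior to
  the convex hull; hence every maximum below is over a non-empty set. The suprema in the dual gauge
  and its restriction are then those of non-empty bounded sets of reals.
\<close>

definition atomic_norm :: "nat \<Rightarrow> (nat \<Rightarrow> real^'m) \<Rightarrow> real^'m \<Rightarrow> real" where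
  "atomic_norm N v x = Max ((\<lambda>i. v i \<bullet> x) ` {1..N})"

definition atoms :: "nat \<Rightarrow> (nat \<Rightarrow> real^'m) \<Rightarrow> bool" where
  "atoms N v \<longleftrightarrow> 0 \<in> interior (convex hull (v ` {1..N})) \<and>
     (\<forall>i\<in>{1..N}. \<exists>x. Max ((\<lambda>j. v j \<bullet> x) ` ({1..N} - {i})) \<noteq> atomic_norm N v x)"

definition dual_gauge :: "nat \<Rightarrow> (nat \<Rightarrow> real^'m) \<Rightarrow> real^'m \<Rightarrow> real" where
  "dual_gauge N v y = Sup {x \<bullet> y |x. atomic_norm N v x \<le> 1}"

definition active :: "nat \<Rightarrow> (nat \<Rightarrow> real^'m) \<Rightarrow> real^'m \<Rightarrow> nat set" where
  "active N v x = {i \<in> {1..N}. v i \<bullet> x = atomic_norm N v x}"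

definition subdiff :: "nat \<Rightarrow> (nat \<Rightarrow> real^'m) \<Rightarrow> real^'m \<Rightarrow> (real^'m) set" where
  "subdiff N v x = convex hull (v ` active N v x)"

text \<open>A pattern is only ever compared with another one; it is identified with the subdifferential.\<close>

definition patt :: "nat \<Rightarrow> (nat \<Rightarrow> real^'m) \<Rightarrow> real^'m \<Rightarrow> (real^'m) set" where
  "patt N v x = subdiff N v x"

definition patt_mat ::
    "nat \<Rightarrow> (nat \<Rightarrow> real^'p lower) \<Rightarrow> 'p::{card2,linorder} sqmat \<Rightarrow> (real^'p lower) set" where
  "patt_mat N v X = patt N v (vec_low X)"

definition patt_space :: "(nat \<Rightarrow> real^'m) \<Rightarrow> nat set \<Rightarrow> (real^'m) set" where
  "patt_space v I = {y. \<forall>i\<in>I. \<forall>j\<in>I. v i \<bullet> y = v j \<bullet> y}"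

text \<open>For non-empty \<open>I\<close> the value does not depend on the chosen element of \<open>I\<close>.\<close>

definition face_proj :: "(nat \<Rightarrow> real^'m) \<Rightarrow> nat set \<Rightarrow> real^'m" where
  "face_proj v I = proj_matrix (patt_space v I) *v v (SOME i. i \<in> I)"

definition dual_gauge_on :: "nat \<Rightarrow> (nat \<Rightarrow> real^'m) \<Rightarrow> nat set \<Rightarrow> real^'m \<Rightarrow> real" where
  "dual_gauge_on N v I y = Sup {x \<bullet> y |x. x \<in> patt_space v I \<and> atomic_norm N v x \<le> 1}"

definition pen :: "nat \<Rightarrow> (nat \<Rightarrow> real^'p lower) \<Rightarrow> 'p::{card2,linorder} sqmat \<Rightarrow> real" where
  "pen N v K = 2 * atomic_norm N v (vec_low K)"

definition model_space ::
    "(nat \<Rightarrow> real^'p lower) \<Rightarrow> nat set \<Rightarrow> ('p::{card2,linorder} sqmat) set" where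
  "model_space v I = {K \<in> Sym. vec_low K \<in> patt_space v I}"

text \<open>
  The constants \<open>\<tau>\<close> and \<open>\<zeta>\<close> may be infinite. \<open>\<tau>\<close> is well defined iff \<open>tau_set\<close> is non-empty.
\<close>

definition tau_set :: "(real^('p \<times> 'p) \<Rightarrow> real) \<Rightarrow> nat \<Rightarrow>
    (nat \<Rightarrow> real^('p::{card2,linorder}) lower) \<Rightarrow> nat set \<Rightarrow> real set" where
  "tau_set \<nu> N v I = {t. 0 \<le> t \<and> (\<forall>\<pi> \<in> orthogonal_comp (patt_space v I).
     \<nu> (dup *v \<pi>) \<le> t \<longrightarrow> dual_gauge N v (face_proj v I + \<pi>) \<le> 1)}"

definition tau :: "(real^('p \<times> 'p) \<Rightarrow> real) \<Rightarrow> nat \<Rightarrow>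
    (nat \<Rightarrow> real^('p::{card2,linorder}) lower) \<Rightarrow> nat set \<Rightarrow> ereal" where
  "tau \<nu> N v I = Sup (ereal ` tau_set \<nu> N v I)"

text \<open>\<open>\<Gamma>\<close> is the matrix \<open>\<Gamma>* = \<Sigma>* \<otimes> \<Sigma>*\<close> belonging to \<open>K = K*\<close>.\<close>

definition zeta :: "(real^('p \<times> 'p) \<Rightarrow> real) \<Rightarrow> nat \<Rightarrow> (nat \<Rightarrow> real^'p lower) \<Rightarrow>
    real^('p \<times> 'p)^('p \<times> 'p) \<Rightarrow> 'p::{card2,linorder} sqmat \<Rightarrow> ereal" where
  "zeta \<nu> N v \<Gamma> K = Sup (ereal ` {z. 0 < z \<and>
     (\<forall>L \<in> model_space v (active N v (vec_low K)).
        \<nu> (\<Gamma> *v vec_col (L - K)) \<le> z \<longrightarrow> patt_mat N v L = patt_mat N v K)})"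


section \<open>Statistical model\<close>

definition cov_matrix :: "'a measure \<Rightarrow> ('a \<Rightarrow> real^'n) \<Rightarrow> real^'n^'n" where
  "cov_matrix M X = (\<chi> i j. \<integral>\<omega>. (X \<omega> $ i - (\<integral>\<omega>'. X \<omega>' $ i \<partial>M)) *
                                (X \<omega> $ j - (\<integral>\<omega>'. X \<omega>' $ j \<partial>M)) \<partial>M)"

text \<open>Not centred at the sample mean, as \<open>X\<close> is assumed to have mean zero.\<close>

definition sample_cov :: "nat \<Rightarrow> (nat \<Rightarrow> real^'n) \<Rightarrow> real^'n^'n" where
  "sample_cov n x = (\<chi> a b. (\<Sum>i=1..n. x i $ a * x i $ b) / real n)"

definition objective :: "nat \<Rightarrow> (nat \<Rightarrow> real^'p lower) \<Rightarrow> real \<Rightarrow> 'p sqmat \<Rightarrow>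
    'p::{card2,linorder} sqmat \<Rightarrow> real" where
  "objective N v l S K = trace (S ** K) - ln (det K) + l * pen N v K"

end

theory Submission
  imports Defs
begin

text \<open>
  Write \<open>W = vec (Sh - \<Sigma>)\<close>, \<open>D\<close> for the duplication matrix,
  \<open>f\<close> for the face projection and \<open>\<M>\<close> for the model space. The
  minimizer is constructed and then recognized. On matrices of \<open>\<M>\<close> with the
  pattern of \<open>K\<close> the penalty is the linear functional \<open>L \<mapsto> D f
  \<bullet> vec L\<close>. So one looks for \<open>Kh = K + \<Delta>\<close> with
  \<open>\<Delta> \<in> \<M>\<close>, whose residual \<open>Z = vec (Sh - Kh\<inverse>) + l D
  f\<close> is orthogonal to \<open>vec \<M>\<close>. Expanding \<open>Kh\<inverse> = \<Sigma> -
  \<Sigma> \<Delta> \<Sigma> + R\<close>, this orthogonality becomes the fixed point equation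
  \<open>vec \<Delta> = - \<Gamma>\<^sub>1\<^sub>1\<^sup>+ (W - R + l D f)\<close>.
  Multiplication of \<open>X\<close> by \<open>\<Delta> \<Sigma>\<close> from the right has
  operator norm at most \<open>r\<close> on the ball \<open>\<nu> (\<Gamma> vec \<Delta>) \<le>
  r / \<eta>\<close>, hence there \<open>\<nu> R \<le> r\<^sup>2 / (\<eta> (1 - r))\<close>, and
  the bound on \<open>\<nu> W\<close> says that the ball is mapped into itself; Brouwer's
  theorem gives a solution (\<open>restricted_stationary_point\<close>).

  The residual of the solution is \<open>Z = (1 - Q) (W - R + l D f)\<close>, and \<open>(1 - Q)
  D f = - \<Gamma>\<^sub>2\<^sub>1 \<Gamma>\<^sub>1\<^sub>1\<^sup>+ D f\<close>. Being symmetric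
  and orthogonal to \<open>\<M>\<close>, it has the form \<open>- l D \<pi>\<close> with
  \<open>\<pi>\<close> orthogonal to the pattern space. The irrepresentability condition and the
  second bound on \<open>\<nu> W\<close> give \<open>\<nu> (D \<pi>) \<le> \<tau>\<close>, so
  \<open>f + \<pi>\<close> lies in the dual unit ball (\<open>tau_dual_gauge\<close>). If
  \<open>Kh\<close> has the pattern of \<open>K\<close>, then \<open>f + \<pi>\<close> is a
  subgradient of the atomic norm at \<open>Kh\<close>, the full stationarity condition holds,
  and strict convexity of \<open>- ln det\<close> makes \<open>Kh\<close> the only minimizer
  (\<open>objective_less\<close>).

  It remains to see that \<open>Kh\<close> has the pattern of \<open>K\<close>. The supremum in
  the definition of \<open>\<zeta>\<close> need not be attained, so \<open>\<nu> (\<Gamma> vec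
  \<Delta>) \<le> r / \<eta> \<le> \<zeta>\<close> is not enough: the inequality must be strict.
  Suppose that \<open>y = - \<Gamma> vec \<Delta>\<close> has norm \<open>r / \<eta>\<close>.
  Then every estimate used above is an equality. Let \<open>A\<close> be multiplication by
  \<open>- \<Delta> \<Sigma>\<close>, so that \<open>R = A y + A\<^sup>2 y + \<dots>\<close>,
  and let \<open>a\<close> be a norming functional of \<open>y\<close>. The equalities force
  \<open>a (Q A\<^sup>k y) = - \<parallel>Q\<parallel> r\<^sup>k \<nu> y\<close> for all
  \<open>k \<ge> 1\<close>. Since \<open>y\<close> lies in the span of the vectors
  \<open>A\<^sup>k y\<close>, \<open>k \<ge> 1\<close>, the same formula holds for \<open>k =
  0\<close> and makes \<open>a (Q y)\<close> negative; but \<open>Q y = y\<close> and \<open>a y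
  = \<nu> y > 0\<close> (\<open>perturbed_projection_norm\<close>,
  \<open>derivative_in_Krylov_space\<close>).
\<close>

section \<open>Symmetric and positive definite matrices\<close>

lemma matrix_diff_ldistrib: "(A::real^'n^'m) ** (B - C) = A ** B - A ** C"
  by (simp add: matrix_matrix_mult_def vec_eq_iff sum_subtractf right_diff_distrib)

lemma matrix_diff_rdistrib: "((A::real^'n^'m) - B) ** C = A ** C - B ** C"
  by (simp add: matrix_matrix_mult_def vec_eq_iff sum_subtractf left_diff_distrib)

lemma matrix_add_rdistrib: "((A::real^'n^'m) + B) ** C = A ** C + B ** C"
  by (simp add: matrix_matrix_mult_def vec_eq_iff sum.distrib distrib_right)

lemma matrix_minus_left: "(- (A::real^'n^'m)) ** C = - (A ** C)"
  by (simp add: matrix_matrix_mult_def vec_eq_iff sum_negf)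

lemma matrix_minus_right: "(A::real^'n^'m) ** (- C) = - (A ** C)"
  by (simp add: matrix_matrix_mult_def vec_eq_iff sum_negf)

lemma transpose_add: "transpose (A + B :: real^'n^'m) = transpose A + transpose B"
  by (simp add: transpose_def vec_eq_iff)

lemma transpose_diff: "transpose (A - B :: real^'n^'m) = transpose A - transpose B"
  by (simp add: transpose_def vec_eq_iff)

lemma transpose_minus: "transpose (- B :: real^'n^'m) = - transpose B"
  by (simp add: transpose_def vec_eq_iff)

lemma inner_transpose: "(transpose A *v x) \<bullet> y = x \<bullet> (A *v (y::real^'n))" for A :: "real^'n^'m"
  by (metis dot_lmul_matrix transpose_matrix_vector)

lemma inner_symmetric: "transpose A = A \<Longrightarrow> (A *v x) \<bullet> y = x \<bullet> (A *v (y::real^'n))"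
  by (metis inner_transpose)

lemma matrix_inv_mult:
  fixes A :: "real^'n^'n"
  assumes "invertible A"
  shows "A ** matrix_inv A = mat 1" "matrix_inv A ** A = mat 1"
proof -
  have "A ** matrix_inv A = mat 1 \<and> matrix_inv A ** A = mat 1"
    unfolding matrix_inv_def
    by (rule someI_ex) (use assms in \<open>simp add: invertible_def\<close>)
  then show "A ** matrix_inv A = mat 1" "matrix_inv A ** A = mat 1" by auto
qed

lemma matrix_inv_eqI:
  fixes A :: "real^'n^'n"
  assumes "A ** B = mat 1"
  shows "invertible A" "matrix_inv A = B"
proof -
  have "B ** A = mat 1" using assms matrix_left_right_inverse by blast
  then show inv: "invertible A" using assms by (auto simp: invertible_def)
  have "matrix_inv A = matrix_inv A ** (A ** B)" using assms by simp
  also have "\<dots> = B" using matrix_inv_mult(2)[OF inv] by (simp add: matrix_mul_assoc)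
  finally show "matrix_inv A = B" .
qed

lemma invertible_if_definite:
  fixes A :: "real^'n^'n"
  assumes "\<And>x. x \<noteq> 0 \<Longrightarrow> 0 < x \<bullet> (A *v x)"
  shows "invertible A"
proof -
  have "\<And>x. A *v x = 0 \<Longrightarrow> x = 0"
    using assms by (metis inner_zero_right less_irrefl)
  then show ?thesis
    by (metis invertible_left_inverse matrix_left_invertible_ker)
qed

lemma matrix_inv_symmetric:
  fixes A :: "real^'n^'n"
  assumes "invertible A" "transpose A = A"
  shows "transpose (matrix_inv A) = matrix_inv A"
proof -
  have "A ** transpose (matrix_inv A) = transpose (matrix_inv A ** A)"
    using assms(2) by (simp add: matrix_transpose_mul)
  also have "\<dots> = mat 1" using matrix_inv_mult[OF assms(1)] by simp
  finally show ?thesis using matrix_inv_eqI(2) by metis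
qed

lemma matrix_inv_pos:
  assumes "A \<in> Sym_pos"
  shows "invertible A" "matrix_inv A \<in> Sym_pos" "matrix_inv (matrix_inv A) = A"
proof -
  show inv: "invertible A"
    using assms by (intro invertible_if_definite) (auto simp: Sym_pos_def)
  show "matrix_inv (matrix_inv A) = A"
    using matrix_inv_mult[OF inv] matrix_inv_eqI by metis
  have sym: "transpose A = A" using assms by (auto simp: Sym_pos_def Sym_def)
  have "0 < x \<bullet> (matrix_inv A *v x)" if "x \<noteq> 0" for x
  proof -
    define y where "y = matrix_inv A *v x"
    have xy: "x = A *v y"
      using matrix_inv_mult[OF inv] by (simp add: y_def matrix_vector_mul_assoc)
    then have "y \<noteq> 0" using that by auto
    then have "0 < y \<bullet> (A *v y)" using assms by (auto simp: Sym_pos_def)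
    then show ?thesis unfolding y_def[symmetric] using xy by (simp add: inner_commute)
  qed
  then show "matrix_inv A \<in> Sym_pos"
    using matrix_inv_symmetric[OF inv sym] by (auto simp: Sym_pos_def Sym_def)
qed

text \<open>
  By Cramer's rule the entries of the inverse are quotients of determinants.
\<close>

lemma continuous_on_matrix_inv:
  fixes f :: "'a::topological_space \<Rightarrow> real^'n^'n"
  assumes "continuous_on S f" "\<And>x. x \<in> S \<Longrightarrow> invertible (f x)"
  shows "continuous_on S (\<lambda>x. matrix_inv (f x))"
proof -
  let ?D = "\<lambda>k j x. det (\<chi> a b. if b = k then mat 1 $ a $ j else f x $ a $ b)"
  have entry: "matrix_inv (f x) $ k $ j = ?D k j x / det (f x)" if "x \<in> S" for x k j
  proof -
    have inv: "invertible (f x)" using assms(2) that by blast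
    have "f x *v (\<chi> k. matrix_inv (f x) $ k $ j) = (\<chi> a. mat 1 $ a $ j)"
      using matrix_inv_mult(1)[OF inv]
      by (simp add: vec_eq_iff matrix_vector_mult_def matrix_matrix_mult_def)
    then have "(\<chi> k. matrix_inv (f x) $ k $ j)
        = (\<chi> k. det (\<chi> a b. if b = k then (\<chi> a. mat 1 $ a $ j) $ a else f x $ a $ b) / det (f x))"
      using cramer[of "f x"] inv by (simp add: invertible_det_nz)
    from arg_cong[OF this, of "\<lambda>w. w $ k"] show ?thesis by (simp cong: if_cong)
  qed
  have det: "continuous_on S (\<lambda>x. det (g x))"
    if "\<And>a b. continuous_on S (\<lambda>x. g x $ a $ b)" for g :: "'a \<Rightarrow> real^'n^'n"
    unfolding det_def by (intro continuous_on_sum continuous_on_mult continuous_on_prod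
        continuous_on_const that)
  have fab: "continuous_on S (\<lambda>x. f x $ a $ b)" for a b
    by (intro continuous_on_component assms)
  have "continuous_on S (\<lambda>x. ?D k j x / det (f x))" for k j
  proof (intro continuous_on_divide det fab ballI)
    fix a b
    show "continuous_on S (\<lambda>x. (\<chi> a b. if b = k then mat 1 $ a $ j else f x $ a $ b) $ a $ b)"
      by (cases "b = k") (simp_all add: fab)
  qed (use assms(2) in \<open>simp add: invertible_det_nz\<close>)
  then have "continuous_on S (\<lambda>x. matrix_inv (f x) $ k $ j)" for k j
    by (rule continuous_on_eq) (use entry in auto)
  then have "continuous_on S (\<lambda>x. \<chi> k j. matrix_inv (f x) $ k $ j)"
    by (intro continuous_on_vec_lambda)
  then show ?thesis by (simp add: vec_lambda_eta)
qed

lemma Sym_posD: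
  assumes "A \<in> Sym_pos"
  shows "transpose A = A" "x \<noteq> 0 \<Longrightarrow> 0 < x \<bullet> (A *v x)"
    "(A *v x) \<bullet> y = x \<bullet> (A *v y)"
  using assms by (auto simp: Sym_pos_def Sym_def inner_symmetric)

text \<open>
  The vector \<open>u\<close> minimizes the Rayleigh quotient of \<open>B\<close> relative to
  \<open>A\<close> over \<open>S\<close>, and the conclusion is the first-order condition at the
  minimum.
\<close>

lemma pencil_eigenvector:
  fixes A B :: "real^'n^'n"
  assumes A: "A \<in> Sym_pos" and B: "transpose B = B" and S: "subspace S" and ne: "\<exists>x\<in>S. x \<noteq> 0"
  obtains u m where "u \<in> S" "u \<bullet> (A *v u) = 1"
    "\<And>x. x \<in> S \<Longrightarrow> x \<bullet> (B *v u) = m * (x \<bullet> (A *v u))"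
proof -
  let ?a = "\<lambda>x. x \<bullet> (A *v x)" and ?b = "\<lambda>x. x \<bullet> (B *v x)"
  have cont: "continuous_on T (\<lambda>x. x \<bullet> (C *v x))" for T and C :: "real^'n^'n"
    by (intro continuous_intros linear_continuous_on matrix_vector_mul_bounded_linear)
  define T where "T = S \<inter> sphere 0 1"
  have "compact T"
    unfolding T_def using closed_subspace[OF S] by (simp add: closed_Int_compact)
  moreover obtain x0 where x0: "x0 \<in> S" "x0 \<noteq> 0" using ne by blast
  then have "x0 /\<^sub>R norm x0 \<in> T"
    using S by (auto simp: T_def subspace_scale)
  then have "T \<noteq> {}" by blast
  moreover have pos: "0 < ?a x" if "x \<noteq> 0" for x using A that Sym_posD(2) by blast
  have "continuous_on T (\<lambda>x. ?b x / ?a x)"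
  proof (intro continuous_on_divide cont ballI)
    fix x assume "x \<in> T"
    then have "x \<noteq> 0" by (auto simp: T_def)
    then show "?a x \<noteq> 0" using pos by fastforce
  qed
  ultimately obtain w where w: "w \<in> T" "\<And>x. x \<in> T \<Longrightarrow> ?b w / ?a w \<le> ?b x / ?a x"
    using continuous_attains_inf[of T "\<lambda>x. ?b x / ?a x"] by blast
  define m where "m = ?b w / ?a w"
  define u where "u = w /\<^sub>R sqrt (?a w)"
  have wS: "w \<in> S" "w \<noteq> 0" using w(1) by (auto simp: T_def)
  have aw: "0 < ?a w" using pos wS by blast
  have uS: "u \<in> S" using wS S by (simp add: u_def subspace_scale)
  have scale: "u \<bullet> (C *v u) = w \<bullet> (C *v w) / (sqrt (?a w))\<^sup>2" for C :: "real^'n^'n"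
    by (simp only: u_def matrix_vector_mult_scaleR inner_scaleR_left inner_scaleR_right
        power2_eq_square divide_inverse inverse_mult_distrib mult_ac)
  have au: "?a u = 1" and bu: "?b u = m" using aw unfolding scale by (simp_all add: m_def)
  have ge: "m * ?a x \<le> ?b x" if "x \<in> S" for x
  proof (cases "x = 0")
    case False
    have "x /\<^sub>R norm x \<in> T" using S False that by (auto simp: T_def subspace_scale)
    then have "m \<le> ?b (x /\<^sub>R norm x) / ?a (x /\<^sub>R norm x)" unfolding m_def by (rule w(2))
    also have "\<dots> = ?b x / ?a x" using False by (simp add: matrix_vector_mult_scaleR)
    finally show ?thesis using pos[OF False] by (simp add: field_simps)
  qed simp
  have "x \<bullet> (B *v u) = m * (x \<bullet> (A *v u))" if x: "x \<in> S" for x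
  proof -
    define d where "d = x \<bullet> (B *v u) - m * (x \<bullet> (A *v u))"
    define e where "e = ?b x - m * ?a x"
    have q: "0 \<le> 2 * t * d + t\<^sup>2 * e" for t
    proof -
      have "u + t *\<^sub>R x \<in> S" using uS x S by (simp add: subspace_add subspace_scale)
      from ge[OF this] have "0 \<le> ?b (u + t *\<^sub>R x) - m * ?a (u + t *\<^sub>R x)" by simp
      also have "?b (u + t *\<^sub>R x) = m + 2 * t * (x \<bullet> (B *v u)) + t\<^sup>2 * ?b x"
        using inner_symmetric[OF B, of x u] bu
        by (simp add: matrix_vector_right_distrib matrix_vector_mult_scaleR inner_add
            power2_eq_square inner_commute algebra_simps)
      also have "?a (u + t *\<^sub>R x) = 1 + 2 * t * (x \<bullet> (A *v u)) + t\<^sup>2 * ?a x"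
        using inner_symmetric[OF Sym_posD(1)[OF A], of x u] au
        by (simp add: matrix_vector_right_distrib matrix_vector_mult_scaleR inner_add
            power2_eq_square inner_commute algebra_simps)
      finally show ?thesis by (simp add: d_def e_def algebra_simps)
    qed
    \<comment> \<open>a quadratic polynomial that is minimal at zero has no linear term\<close>
    have "d = 0"
    proof (rule ccontr)
      assume "d \<noteq> 0"
      define s where "s = 1 / (1 + \<bar>e\<bar>)"
      have s: "0 < s" "s * e \<le> 1" by (auto simp: s_def field_simps)
      have "0 \<le> 2 * (- s * d) * d + (- s * d)\<^sup>2 * e" by (rule q)
      also have "\<dots> = s * d\<^sup>2 * (s * e - 2)" by (simp add: power2_eq_square algebra_simps)
      also have "\<dots> < 0" using s \<open>d \<noteq> 0\<close> by (intro mult_pos_neg) auto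
      finally show False by simp
    qed
    then show ?thesis by (simp add: d_def)
  qed
  then show thesis using that uS au by blast
qed

text \<open>
  Generalized eigenvectors are collected one at a time: the next one is taken in the
  \<open>A\<close>-orthogonal complement of those already found, which is nonzero as long as
  there are fewer than \<open>CARD('n)\<close> of them.
\<close>

lemma pencil_eigensystem:
  fixes A B :: "real^'n^'n"
  assumes A: "A \<in> Sym_pos" and B: "transpose B = B" and "k \<le> CARD('n)"
  shows "\<exists>T. finite T \<and> card T = k \<and> (\<forall>x\<in>T. \<forall>y\<in>T. x \<bullet> (A *v y) = (if x = y then 1 else 0)) \<and>
           (\<forall>x\<in>T. \<exists>m. B *v x = m *\<^sub>R (A *v x))"
  using \<open>k \<le> CARD('n)\<close>
proof (induction k)
  case 0
  show ?case by (intro exI[of _ "{}"]) auto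
next
  case (Suc k)
  then obtain T where T: "finite T" "card T = k"
    and ort: "\<And>x y. x \<in> T \<Longrightarrow> y \<in> T \<Longrightarrow> x \<bullet> (A *v y) = (if x = y then 1 else 0)"
    and eig: "\<And>x. x \<in> T \<Longrightarrow> \<exists>m. B *v x = m *\<^sub>R (A *v x)"
    by auto
  note symA = Sym_posD(3)[OF A] and symB = inner_symmetric[OF B]
  define S where "S = {x. \<forall>t\<in>T. x \<bullet> (A *v t) = 0}"
  have S: "subspace S" by (auto simp: S_def subspace_def inner_add)
  have "dim ((*v) A ` T) \<le> card ((*v) A ` T)" using T by (simp add: dim_le_card')
  also have "\<dots> \<le> k" using T card_image_le by blast
  finally have "dim ((*v) A ` T) < DIM(real^'n)" using Suc.prems by simp
  then obtain x0 where x0: "x0 \<noteq> 0" "\<And>y. y \<in> span ((*v) A ` T) \<Longrightarrow> orthogonal x0 y"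
    using orthogonal_to_subspace_exists by blast
  then have "x0 \<in> S" by (auto simp: S_def orthogonal_def span_base)
  then obtain u m where u: "u \<in> S" "u \<bullet> (A *v u) = 1"
    and um: "\<And>x. x \<in> S \<Longrightarrow> x \<bullet> (B *v u) = m * (x \<bullet> (A *v u))"
    using pencil_eigenvector[OF A B S] x0 by blast
  have uT: "t \<bullet> (A *v u) = 0" "u \<bullet> (A *v t) = 0" "t \<bullet> (B *v u) = 0" if t: "t \<in> T" for t
  proof -
    show 1: "u \<bullet> (A *v t) = 0" using u(1) t by (simp add: S_def)
    then show "t \<bullet> (A *v u) = 0" using symA[of u t] by (simp add: inner_commute)
    obtain m' where "B *v t = m' *\<^sub>R (A *v t)" using eig[OF t] by blast
    then show "t \<bullet> (B *v u) = 0" using 1 symB[of t u] by (simp add: inner_commute)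
  qed
  have "x \<bullet> (B *v u - m *\<^sub>R (A *v u)) = 0" for x
  proof -
    define x' where "x' = x - (\<Sum>t\<in>T. (x \<bullet> (A *v t)) *\<^sub>R t)"
    have "x' \<in> S"
      using T(1) by (auto simp: S_def x'_def inner_diff_left inner_sum_left ort if_distrib
          cong: sum.cong if_cong)
    then have "x' \<bullet> (B *v u - m *\<^sub>R (A *v u)) = 0" using um by (simp add: inner_diff_right)
    moreover have "(\<Sum>t\<in>T. (x \<bullet> (A *v t)) *\<^sub>R t) \<bullet> (B *v u - m *\<^sub>R (A *v u)) = 0"
      by (simp add: inner_sum_left inner_diff_right uT)
    ultimately show ?thesis by (simp add: x'_def inner_diff_left)
  qed
  then have "B *v u - m *\<^sub>R (A *v u) = 0" using inner_eq_zero_iff by blast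
  then have Bu: "B *v u = m *\<^sub>R (A *v u)" by simp
  have "u \<notin> T" using uT u by fastforce
  then show ?case
    using T u uT ort eig Bu
    by (intro exI[of _ "insert u T"]) auto
qed

text \<open>
  Reduction to an \<open>A\<close>-orthonormal eigenbasis of the pencil. It replaces the
  spectral theorem and matrix square roots throughout.
\<close>

lemma simultaneous_diagonalization:
  fixes A B :: "real^'n^'n"
  assumes A: "A \<in> Sym_pos" and B: "transpose B = B"
  obtains C :: "real^'n^'n" and m :: "'n \<Rightarrow> real" where "invertible C" "transpose C ** A ** C = mat 1"
    "\<And>i j. (transpose C ** B ** C) $ i $ j = (if i = j then m i else 0)"
    "\<And>i. B *v column i C = m i *\<^sub>R (A *v column i C)"
proof -
  obtain T where T: "finite T" "card T = CARD('n)"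
    and ort: "\<forall>x\<in>T. \<forall>y\<in>T. x \<bullet> (A *v y) = (if x = y then 1 else 0)"
    and eig: "\<forall>x\<in>T. \<exists>m. B *v x = m *\<^sub>R (A *v x)"
    using pencil_eigensystem[OF A B order.refl] by blast
  obtain q where q: "bij_betw q (UNIV::'n set) T"
    using T finite_same_card_bij[of "UNIV::'n set" T] by auto
  have qT: "q i \<in> T" and qi: "q i = q j \<longleftrightarrow> i = j" for i j
    using q by (auto simp: bij_betw_def inj_on_def)
  define m where "m i = (SOME m. B *v q i = m *\<^sub>R (A *v q i))" for i
  have m: "B *v q i = m i *\<^sub>R (A *v q i)" for i
    unfolding m_def by (rule someI_ex) (use eig qT in blast)
  define C :: "real^'n^'n" where "C = (\<chi> a i. q i $ a)"
  have col: "column i C = q i" for i unfolding C_def column_def by (simp add: vec_lambda_eta)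
  have entry: "(transpose C ** D ** C) $ i $ j = q i \<bullet> (D *v q j)" for D :: "real^'n^'n" and i j
    by (simp add: C_def matrix_matrix_mult_def transpose_def inner_vec_def
        matrix_vector_mult_def sum_distrib_left sum_distrib_right mult.assoc)
      (rule sum.swap)
  have 1: "transpose C ** A ** C = mat 1"
    unfolding vec_eq_iff by (simp add: entry ort qT qi mat_def)
  moreover have "(transpose C ** B ** C) $ i $ j = (if i = j then m i else 0)" for i j
    by (simp add: entry m ort qT qi)
  moreover have "invertible C" using 1 by (metis invertible_left_inverse)
  ultimately show thesis using that m col by metis
qed

lemma Sym_pos_factor:
  fixes A :: "real^'n^'n"
  assumes A: "A \<in> Sym_pos"
  obtains C :: "real^'n^'n" where "invertible C" "A = transpose C ** C"
proof -
  obtain D :: "real^'n^'n" where D: "invertible D" "transpose D ** A ** D = mat 1"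
    using simultaneous_diagonalization[OF A Sym_posD(1)[OF A]] by metis
  define C where "C = matrix_inv D"
  note inv = matrix_inv_mult[OF D(1), folded C_def]
  have t: "transpose C ** transpose D = mat 1"
    using inv(1) by (simp flip: matrix_transpose_mul)
  have "transpose C ** C = transpose C ** (transpose D ** A ** D) ** C" using D by simp
  also have "\<dots> = (transpose C ** transpose D) ** A ** (D ** C)" by (simp add: matrix_mul_assoc)
  also have "\<dots> = A" using t inv by simp
  finally have "A = transpose C ** C" by simp
  moreover have "invertible C" using inv by (auto simp: invertible_def)
  ultimately show thesis using that by blast
qed

lemma invertible_column_nonzero:
  fixes C :: "real^'n^'n"
  assumes "invertible C"
  shows "column i C \<noteq> 0"
proof
  assume "column i C = 0"
  then have "C *v axis i 1 = 0" by (simp add: matrix_vector_mult_basis)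
  then have "axis i 1 = (0::real^'n)"
    using assms by (metis invertible_left_inverse matrix_left_invertible_ker)
  then show False by (simp add: axis_eq_0_iff)
qed

text \<open>
  Strict concavity of \<open>ln det\<close>, as its tangent inequality at \<open>A\<close>.
  After simultaneous diagonalization it is the sum of the inequalities \<open>ln m \<le> m -
  1\<close> over the eigenvalues of \<open>B\<close> relative to \<open>A\<close>.
\<close>

lemma ln_det_less_trace:
  fixes A B :: "real^'n^'n"
  assumes A: "A \<in> Sym_pos" and B: "B \<in> Sym_pos" and "B \<noteq> A"
  shows "ln (det B) - ln (det A) < trace (matrix_inv A ** (B - A))"
proof -
  obtain C :: "real^'n^'n" and m :: "'n \<Rightarrow> real" where C: "invertible C" "transpose C ** A ** C = mat 1"
    and CB: "\<And>i j. (transpose C ** B ** C) $ i $ j = (if i = j then m i else 0)"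
    using simultaneous_diagonalization[OF A Sym_posD(1)[OF B]] by metis
  have colpos: "0 < m i" for i
  proof -
    have "column i C \<noteq> 0" by (rule invertible_column_nonzero[OF C(1)])
    then have "0 < column i C \<bullet> (B *v column i C)" using Sym_posD(2)[OF B] by blast
    also have "\<dots> = (transpose C ** B ** C) $ i $ i"
      by (simp add: column_def matrix_matrix_mult_def transpose_def inner_vec_def
          matrix_vector_mult_def sum_distrib_left sum_distrib_right mult.assoc)
        (rule sum.swap)
    finally show ?thesis by (simp add: CB)
  qed
  have dA: "det C * det A * det C = 1"
    using arg_cong[OF C(2), of det] by (simp add: det_mul)
  have "det (transpose C ** B ** C) = (\<Prod>i\<in>UNIV. m i)"
    by (subst det_diagonal) (auto simp: CB)
  then have dB: "det C * det B * det C = (\<Prod>i\<in>UNIV. m i)" by (simp add: det_mul)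
  have c0: "det C \<noteq> 0" using C(1) invertible_det_nz by blast
  then have c: "0 < det C * det C" by (metis not_real_square_gt_zero)
  have detA: "det A = 1 / (det C * det C)" using dA c0 by (simp add: eq_divide_eq mult_ac)
  have detB: "det B = (\<Prod>i\<in>UNIV. m i) / (det C * det C)" using dB c0 by (simp add: eq_divide_eq mult_ac)
  have "ln (P / d) - ln (1 / d) = ln P" if "0 < d" "0 < P" for P d :: real
    using that by (simp add: ln_div)
  from this[OF c] have "ln (det B) - ln (det A) = ln (\<Prod>i\<in>UNIV. m i)"
    unfolding detA detB using colpos by (simp add: prod_pos)
  also have "\<dots> = (\<Sum>i\<in>UNIV. ln (m i))" 
  proof (rule ln_prod)
    show "m i \<noteq> 0" for i using colpos[of i] by simp
  qed simp
  finally have L: "ln (det B) - ln (det A) = (\<Sum>i\<in>UNIV. ln (m i))" .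
  have invA: "matrix_inv A = C ** transpose C"
  proof (rule matrix_inv_eqI)
    have "(transpose C ** A) ** C = mat 1" using C(2) .
    then have "C ** (transpose C ** A) = mat 1" using matrix_left_right_inverse by blast
    then have "(C ** transpose C) ** A = mat 1" by (simp add: matrix_mul_assoc)
    then show "A ** (C ** transpose C) = mat 1" using matrix_left_right_inverse by blast
  qed
  have "trace (matrix_inv A ** (B - A)) = trace (transpose C ** (B - A) ** C)"
    unfolding invA by (metis matrix_mul_assoc trace_mul_sym)
  also have "transpose C ** (B - A) ** C = transpose C ** B ** C - mat 1"
    by (simp add: matrix_diff_ldistrib matrix_diff_rdistrib C)
  also have "trace \<dots> = (\<Sum>i\<in>UNIV. m i - 1)"
    by (simp add: trace_def CB mat_def)
  finally have R: "trace (matrix_inv A ** (B - A)) = (\<Sum>i\<in>UNIV. m i - 1)" .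
  have "\<exists>i. m i \<noteq> 1"
  proof (rule ccontr)
    assume "\<not> ?thesis"
    then have "transpose C ** B ** C = transpose C ** A ** C"
      by (simp add: vec_eq_iff C CB mat_def)
    moreover have "invertible (transpose C)" using C(1) by (simp add: transpose_invertible)
    ultimately have "matrix_inv (transpose C) ** (transpose C ** B ** C) ** matrix_inv C
      = matrix_inv (transpose C) ** (transpose C ** A ** C) ** matrix_inv C" by simp
    then have "(matrix_inv (transpose C) ** transpose C) ** B ** (C ** matrix_inv C)
      = (matrix_inv (transpose C) ** transpose C) ** A ** (C ** matrix_inv C)"
      by (simp add: matrix_mul_assoc)
    then have "B = A"
      using matrix_inv_mult[OF C(1)] matrix_inv_mult[OF \<open>invertible (transpose C)\<close>] by simp
    then show False using \<open>B \<noteq> A\<close> by simp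
  qed
  then obtain i where i: "m i \<noteq> 1" by blast
  have "(\<Sum>i\<in>UNIV. ln (m i)) < (\<Sum>i\<in>UNIV. m i - 1)"
  proof (rule sum_strict_mono_ex1)
    show "\<forall>x\<in>UNIV. ln (m x) \<le> m x - 1" using colpos ln_le_minus_one by blast
    show "\<exists>x\<in>UNIV. ln (m x) < m x - 1"
      using i colpos ln_le_minus_one ln_eq_minus_one by (metis UNIV_I order_less_le)
  qed simp
  then show ?thesis using L R by simp
qed

section \<open>Vectorization\<close>

definition unvec :: "real^('n \<times> 'n) \<Rightarrow> real^'n^'n" where
  "unvec x = (\<chi> i j. x $ (j, i))"

lemma unvec_vec_col [simp]: "unvec (vec_col X) = X"
  by (simp add: unvec_def vec_col_def vec_eq_iff)

lemma vec_col_unvec [simp]: "vec_col (unvec x) = x"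
  by (simp add: unvec_def vec_col_def vec_eq_iff)

lemma linear_vec_col: "linear (vec_col :: real^'n^'n \<Rightarrow> _)"
  by (rule linearI) (simp_all add: vec_col_def vec_eq_iff)

lemma linear_unvec: "linear unvec"
  by (rule linearI) (simp_all add: unvec_def vec_eq_iff)

lemma linear_vec_low: "linear (vec_low :: 'p::{card2,linorder} sqmat \<Rightarrow> _)"
  by (rule linearI) (simp_all add: vec_low_def vec_eq_iff)

lemmas vec_col_diff = linear_diff[OF linear_vec_col]
  and vec_col_add = linear_add[OF linear_vec_col]
  and vec_col_scaleR = linear_scale[OF linear_vec_col]
  and vec_col_minus = linear_neg[OF linear_vec_col]
  and vec_col_0 = linear_0[OF linear_vec_col]
  and vec_low_diff = linear_diff[OF linear_vec_low]
  and vec_low_add = linear_add[OF linear_vec_low]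
  and vec_low_scaleR = linear_scale[OF linear_vec_low]

lemma vec_col_eq_iff: "vec_col X = vec_col Y \<longleftrightarrow> X = (Y :: real^'n^'n)"
  by (metis unvec_vec_col)

lemma inner_vec_col: "vec_col X \<bullet> vec_col Y = trace (transpose X ** Y)"
  for X Y :: "real^'n^'n"
  by (simp add: inner_vec_def vec_col_def trace_def matrix_matrix_mult_def transpose_def
      sum.cartesian_product UNIV_Times_UNIV[symmetric] case_prod_beta del: UNIV_Times_UNIV)

lemma sum_pairs: "(\<Sum>k\<in>UNIV. h (fst k) (snd k)) = (\<Sum>a\<in>UNIV. \<Sum>b\<in>UNIV. h a b)"
  for h :: "'a::finite \<Rightarrow> 'b::finite \<Rightarrow> real"
  by (simp add: sum.cartesian_product case_prod_beta)

lemma kron_vec_col: "kron A B *v vec_col X = vec_col (B ** X ** transpose A)"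
  for A B X :: "real^'n^'n"
proof -
  have "(\<Sum>k\<in>UNIV. A $ i $ fst k * B $ j $ snd k * X $ snd k $ fst k)
      = (\<Sum>k\<in>UNIV. (\<Sum>l\<in>UNIV. B $ j $ l * X $ l $ k) * A $ i $ k)" for i j
    using sum_pairs[of "\<lambda>k l. A $ i $ k * B $ j $ l * X $ l $ k"]
    by (simp add: sum_distrib_left mult_ac)
  then show ?thesis
    by (simp add: vec_eq_iff kron_def vec_col_def matrix_vector_mult_def
        matrix_matrix_mult_def transpose_def)
qed

lemma kron_mult: "kron A B ** kron C D = kron (A ** C) (B ** D)"
  for A B C D :: "real^'n^'n"
proof -
  have "(kron A B ** kron C D) *v x = kron (A ** C) (B ** D) *v x" for x
  proof -
    have "(kron A B ** kron C D) *v vec_col (unvec x) = kron (A ** C) (B ** D) *v vec_col (unvec x)"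
      by (simp only: matrix_vector_mul_assoc[symmetric] kron_vec_col matrix_transpose_mul
          matrix_mul_assoc)
    then show ?thesis by simp
  qed
  then show ?thesis by (simp add: matrix_eq)
qed

lemma transpose_kron: "transpose (kron A B) = kron (transpose A) (transpose B)"
  by (simp add: kron_def transpose_def vec_eq_iff)

text \<open>
  If \<open>A = C\<^sup>T C\<close>, then \<open>A \<otimes> A = (C \<otimes> C)\<^sup>T (C
  \<otimes> C)\<close>, and \<open>C \<otimes> C\<close> is injective because it acts on
  matrices as \<open>X \<mapsto> C X C\<^sup>T\<close>.
\<close>

lemma kron_Sym_pos:
  fixes A :: "real^'n^'n"
  assumes "A \<in> Sym_pos"
  shows "kron A A \<in> Sym_pos"
proof -
  obtain C :: "real^'n^'n" where C: "invertible C" "A = transpose C ** C"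
    using Sym_pos_factor[OF assms] .
  have f: "kron A A = transpose (kron C C) ** kron C C"
    by (simp add: transpose_kron kron_mult C)
  have "0 < x \<bullet> (kron A A *v x)" if "x \<noteq> 0" for x
  proof -
    have "kron C C *v x \<noteq> 0"
    proof
      assume "kron C C *v x = 0"
      then have "vec_col (C ** unvec x ** transpose C) = 0"
        using kron_vec_col[of C C "unvec x"] by simp
      then have 0: "C ** unvec x ** transpose C = 0"
        by (metis vec_col_0 vec_col_eq_iff)
      have "invertible (transpose C)" using C(1) by (simp add: transpose_invertible)
      note inv = matrix_inv_mult[OF C(1)] matrix_inv_mult[OF this]
      have "unvec x = (matrix_inv C ** C) ** unvec x ** (transpose C ** matrix_inv (transpose C))"
        by (simp add: inv)
      also have "\<dots> = matrix_inv C ** (C ** unvec x ** transpose C) ** matrix_inv (transpose C)"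
        by (simp add: matrix_mul_assoc)
      also have "\<dots> = 0" by (simp add: 0)
      finally show False using that by (metis vec_col_0 vec_col_unvec)
    qed
    moreover have "x \<bullet> (kron A A *v x) = (kron C C *v x) \<bullet> (kron C C *v x)"
      unfolding f by (metis dot_lmul_matrix inner_commute matrix_vector_mul_assoc
          transpose_matrix_vector)
    ultimately show ?thesis by simp
  qed
  moreover have "transpose (kron A A) = kron A A"
    by (simp add: transpose_kron Sym_posD[OF assms])
  ultimately show ?thesis by (simp add: Sym_pos_def Sym_def)
qed

lemma Rep_lower_less: "fst (Rep_lower k) < snd (Rep_lower k)"
    "\<not> snd (Rep_lower k) < fst (Rep_lower k)" "fst (Rep_lower k) \<noteq> snd (Rep_lower k)"
  using Rep_lower[of k] by (auto simp: case_prod_beta)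

lemma ex_lower: "a < b \<Longrightarrow> \<exists>k. Rep_lower k = (a, b)"
  by (metis (mono_tags, lifting) Abs_lower_inverse case_prod_conv mem_Collect_eq)

definition sym_of_low :: "real^('p::{card2,linorder}) lower \<Rightarrow> 'p sqmat" where
  "sym_of_low x = (\<chi> i j. if j < i then x $ Abs_lower (j, i)
     else if i < j then x $ Abs_lower (i, j) else 0)"

lemma sym_of_low:
  shows "sym_of_low x \<in> Sym_zero" "vec_low (sym_of_low x) = x"
proof -
  show "sym_of_low x \<in> Sym_zero"
    by (auto simp: sym_of_low_def Sym_zero_def Sym_def transpose_def vec_eq_iff)
  have "Abs_lower (fst (Rep_lower k), snd (Rep_lower k)) = k" for k :: "'a lower"
    by (simp add: Rep_lower_inverse)
  then show "vec_low (sym_of_low x) = x"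
    by (simp add: sym_of_low_def vec_low_def vec_eq_iff Rep_lower_less)
qed

lemma Sym_zero_eqI:
  assumes "X \<in> Sym_zero" "Y \<in> Sym_zero" "vec_low X = vec_low Y"
  shows "X = Y"
proof -
  have low: "X $ i $ j = Y $ i $ j" if ji: "j < i" for i j
  proof -
    obtain k where "Rep_lower k = (j, i)" using ex_lower[OF ji] by blast
    then show ?thesis using arg_cong[OF assms(3), of "\<lambda>x. x $ k"] by (simp add: vec_low_def)
  qed
  have tr: "Z $ i $ j = Z $ j $ i" if "Z \<in> Sym_zero" for Z :: "'a sqmat" and i j
    using that by (auto simp: Sym_zero_def Sym_def transpose_def vec_eq_iff)
  have "X $ i $ j = Y $ i $ j" for i j
  proof (cases i j rule: linorder_cases)
    case less
    then show ?thesis using low[OF less] tr assms(1,2) by metis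
  next
    case equal
    then show ?thesis using assms(1,2) by (simp add: Sym_zero_def)
  qed (rule low)
  then show ?thesis by (simp add: vec_eq_iff)
qed

text \<open>
  Every vector is the lower part of exactly one symmetric matrix with zero diagonal; this
  determines the duplication matrix.
\<close>

lemma dup_vec:
  fixes x :: "real^('p::{card2,linorder}) lower"
  shows "dup *v x = vec_col (sym_of_low x)"
proof -
  let ?f = "\<lambda>x :: real^'p lower. vec_col (sym_of_low x)"
  have "linear ?f"
    by (rule linearI) (simp_all add: vec_col_def sym_of_low_def vec_eq_iff)
  then have f: "matrix ?f *v x = ?f x" for x using matrix_vector_mul(2) by metis
  have "dup = matrix ?f"
    unfolding dup_def
  proof (rule the_equality)
    show "\<forall>X\<in>Sym_zero. matrix ?f *v vec_low X = vec_col X"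
      using f sym_of_low Sym_zero_eqI by metis
    fix D :: "real^'p lower^('p \<times> 'p)"
    assume "\<forall>X\<in>Sym_zero. D *v vec_low X = vec_col X"
    then have "D *v x = matrix ?f *v x" for x using f sym_of_low by metis
    then show "D = matrix ?f" by (simp add: matrix_eq)
  qed
  then show ?thesis using f by simp
qed

lemma sum_lower:
  fixes f :: "'p::{card2,linorder} \<Rightarrow> 'p \<Rightarrow> real"
  shows "(\<Sum>k\<in>UNIV. f (fst (Rep_lower k)) (snd (Rep_lower k))) = (\<Sum>(j, i) | j < i. f j i)"
  by (rule sum.reindex_bij_witness[of _ Abs_lower Rep_lower])
    (auto simp: Rep_lower_inverse Abs_lower_inverse case_prod_beta Rep_lower_less)

text \<open>
  Each strictly lower entry of a symmetric matrix is counted twice, and the diagonal of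
  \<open>X\<close> meets zeros.
\<close>

lemma inner_dup:
  assumes "X \<in> Sym"
  shows "(dup *v x) \<bullet> vec_col X = 2 * (x \<bullet> vec_low X)"
proof -
  let ?S = "sym_of_low x"
  have tr: "Z $ i $ j = Z $ j $ i" if "Z \<in> Sym" for Z :: "'a sqmat" and i j
    using that by (auto simp: Sym_def transpose_def vec_eq_iff)
  have S: "?S \<in> Sym" "\<And>i. ?S $ i $ i = 0" using sym_of_low(1)[of x] by (auto simp: Sym_zero_def)
  define g where "g = (\<lambda>(j, i). ?S $ i $ j * X $ i $ j)"
  have g: "g (j, i) = g (i, j)" for i j using tr[OF S(1), of i j] tr[OF assms, of i j] by (simp add: g_def)
  have "(dup *v x) \<bullet> vec_col X = (\<Sum>k\<in>UNIV. g k)"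
    by (simp add: dup_vec inner_vec_def vec_col_def g_def case_prod_beta)
  also have "\<dots> = (\<Sum>k\<in>{(j, i). j < i} \<union> ({(j, i). i < j} \<union> {(j, i). i = j}). g k)"
    by (rule sum.cong) auto
  also have "\<dots> = sum g {(j, i). j < i} + (sum g {(j, i). i < j} + sum g {(j, i). i = j})"
    by (subst sum.union_disjoint; (subst sum.union_disjoint)?) auto
  also have "sum g {(j, i). i = j} = 0"
    by (rule sum.neutral) (auto simp: g_def S)
  also have "sum g {(j, i). i < j} = sum g {(j, i). j < i}"
    by (rule sum.reindex_bij_witness[of _ "\<lambda>(j, i). (i, j)" "\<lambda>(j, i). (i, j)"]) (auto simp: g)
  also have "sum g {(j, i). j < i} = vec_low ?S \<bullet> vec_low X"
    using sum_lower[of "\<lambda>j i. g (j, i)"]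
    by (simp add: inner_vec_def vec_low_def g_def case_prod_beta)
  finally show ?thesis by (simp add: sym_of_low)
qed

section \<open>Projections and pseudoinverses\<close>

lemma proj_matrix_spec:
  fixes S :: "(real^'n) set"
  assumes "subspace S"
  shows "proj_matrix S *v x \<in> S" "x - proj_matrix S *v x \<in> orthogonal_comp S"
proof -
  have "\<exists>y. y \<in> S \<and> x - y \<in> orthogonal_comp S" for x
  proof -
    obtain y z where "y \<in> span S" "\<And>w. w \<in> span S \<Longrightarrow> orthogonal z w" "x = y + z"
      using orthogonal_subspace_decomp_exists[of S x] by blast
    then show ?thesis
      using assms by (intro exI[of _ y])
        (auto simp: orthogonal_comp_def orthogonal_commute span_eq_iff[THEN iffD2])
  qed
  then obtain p where p: "\<And>x. p x \<in> S" "\<And>x. x - p x \<in> orthogonal_comp S" by metis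
  have uniq: "y = z" if "y \<in> S" "z \<in> S" "x - y \<in> orthogonal_comp S" "x - z \<in> orthogonal_comp S"
    for x y z
  proof -
    have "y - z \<in> S" using that assms by (simp add: subspace_diff)
    moreover have "y - z \<in> orthogonal_comp S"
      using subspace_diff[OF subspace_orthogonal_comp that(4,3)] by simp
    ultimately have "(y - z) \<bullet> (y - z) = 0" by (auto simp: orthogonal_comp_def orthogonal_def)
    then show ?thesis by simp
  qed
  have "linear p"
  proof (rule linearI)
    fix x y and c :: real
    show "p (x + y) = p x + p y"
      using subspace_add[OF subspace_orthogonal_comp p(2)[of x] p(2)[of y]]
      by (intro uniq[of _ _ "x + y"] p subspace_add assms) (simp add: algebra_simps)
    show "p (c *\<^sub>R x) = c *\<^sub>R p x"
      using subspace_scale[OF subspace_orthogonal_comp p(2)[of x], of c]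
      by (intro uniq[of _ _ "c *\<^sub>R x"] p subspace_scale assms) (simp add: algebra_simps)
  qed
  then have m: "matrix p *v x = p x" for x using matrix_vector_mul(2) by metis
  have "proj_matrix S = matrix p"
    unfolding proj_matrix_def
  proof (rule the_equality)
    show "\<forall>x. matrix p *v x \<in> S \<and> x - matrix p *v x \<in> orthogonal_comp S" using p m by simp
    fix P assume "\<forall>x. P *v x \<in> S \<and> x - P *v x \<in> orthogonal_comp S"
    then have "P *v x = matrix p *v x" for x using uniq p m by metis
    then show "P = matrix p" by (simp add: matrix_eq)
  qed
  then show "proj_matrix S *v x \<in> S" "x - proj_matrix S *v x \<in> orthogonal_comp S"
    using p m by auto
qed

lemma proj_matrix_props:
  fixes S :: "(real^'n) set"
  assumes S: "subspace S"
  defines "P \<equiv> proj_matrix S"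
  shows "x \<in> S \<Longrightarrow> P *v x = x"
    "transpose P = P" "P ** P = P"
    "(P *v x = 0) = (x \<in> orthogonal_comp S)"
proof -
  note P = proj_matrix_spec[OF S, folded P_def]
  have ort: "a \<bullet> b = 0" "b \<bullet> a = 0" if "a \<in> S" "b \<in> orthogonal_comp S" for a b
    using that by (auto simp: orthogonal_comp_def orthogonal_def inner_commute)
  show fixS: "P *v x = x" if "x \<in> S" for x
  proof -
    have "(x - P *v x) \<bullet> (x - P *v x) = 0"
      using P[of x] ort subspace_diff[OF S that P(1)] by blast
    then show ?thesis by simp
  qed
  show "P ** P = P" using fixS P by (simp add: matrix_eq flip: matrix_vector_mul_assoc)
  have sym: "(P *v x) \<bullet> y = x \<bullet> (P *v y)" for x y
    using ort(1)[OF P(1)[of x] P(2)[of y]] ort(2)[OF P(1)[of y] P(2)[of x]]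
    by (simp add: inner_diff_left inner_diff_right)
  have "transpose P *v x = P *v x" for x
  proof -
    have "(transpose P *v x - P *v x) \<bullet> y = 0" for y
      by (simp add: inner_diff_left inner_transpose sym del: transpose_matrix_vector)
    then show ?thesis by (metis inner_eq_zero_iff eq_iff_diff_eq_0)
  qed
  then show "transpose P = P" by (metis matrix_eq)
  show "(P *v x = 0) = (x \<in> orthogonal_comp S)"
  proof
    assume "P *v x = 0" then show "x \<in> orthogonal_comp S" using P(2)[of x] by simp
  next
    assume "x \<in> orthogonal_comp S"
    then have "(P *v x) \<bullet> (P *v x) = 0" using sym[of x "P *v x"] fixS P(1) ort by metis
    then show "P *v x = 0" by simp
  qed
qed

text \<open>
  The Penrose equations have at most one solution: any two solutions yield the same products
  \<open>A B\<close> and \<open>B A\<close>.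
\<close>

lemma pinv_eqI:
  fixes A :: "real^'n^'m"
  assumes B: "A ** B ** A = A" "B ** A ** B = B"
    "transpose (A ** B) = A ** B" "transpose (B ** A) = B ** A"
  shows "pinv A = B"
  unfolding pinv_def
proof (rule the_equality)
  fix C :: "real^'m^'n"
  assume C: "A ** C ** A = A \<and> C ** A ** C = C \<and> transpose (A ** C) = A ** C \<and> transpose (C ** A) = C ** A"
  have 1: "A ** B = A ** C"
  proof -
    have "A ** B = transpose (A ** C ** A ** B)" using B C by simp
    also have "\<dots> = transpose (A ** B) ** transpose (A ** C)"
      by (simp add: matrix_transpose_mul matrix_mul_assoc)
    also have "\<dots> = A ** B ** A ** C" using B C by (simp add: matrix_mul_assoc)
    finally show ?thesis using B by simp
  qed
  have 2: "B ** A = C ** A"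
  proof -
    have "B ** A = transpose (B ** (A ** C ** A))" using B C by simp
    also have "\<dots> = transpose (C ** A) ** transpose (B ** A)"
      by (simp add: matrix_transpose_mul matrix_mul_assoc)
    also have "\<dots> = C ** (A ** B ** A)" using B(4) C by (simp add: matrix_mul_assoc)
    finally show ?thesis using B(1) by (simp flip: matrix_mul_assoc)
  qed
  have "C = C ** (A ** C)" using C by (simp add: matrix_mul_assoc)
  also have "\<dots> = (C ** A) ** B" by (simp add: 1[symmetric] matrix_mul_assoc)
  also have "\<dots> = B" using B by (simp add: 2[symmetric])
  finally show "C = B" .
qed (use B in blast)

text \<open>
  On the range of \<open>P\<close> the compression of a positive definite \<open>G\<close> is
  invertible. Completed by the identity on the kernel of \<open>P\<close> it becomes the
  positive definite matrix \<open>N\<close>, and the pseudoinverse is \<open>N\<inverse>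
  P\<close>.
\<close>

lemma pinv_compression:
  fixes G P :: "real^'n^'n"
  assumes G: "G \<in> Sym_pos" and P: "transpose P = P" "P ** P = P"
  defines "J \<equiv> pinv (P ** G ** P)"
  shows "J ** (P ** G ** P) = P" "(P ** G ** P) ** J = P" "P ** J = J" "J ** P = J"
proof -
  define A where "A = P ** G ** P"
  define N where "N = A + (mat 1 - P)"
  have PA: "P ** A = A" "A ** P = A"
    using P(2) by (simp_all add: A_def matrix_mul_assoc) (simp_all flip: matrix_mul_assoc add: P)
  have "0 < x \<bullet> (N *v x)" if "x \<noteq> 0" for x
  proof -
    have s: "x \<bullet> (P *v y) = (P *v x) \<bullet> y" for x y using inner_symmetric[OF P(1)] by metis
    have "x \<bullet> (A *v x) = (P *v x) \<bullet> (G *v (P *v x))"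
      by (simp add: A_def s flip: matrix_vector_mul_assoc)
    moreover have "x \<bullet> ((mat 1 - P) *v x) = (x - P *v x) \<bullet> (x - P *v x)"
    proof -
      have "(P *v x) \<bullet> (P *v x) = x \<bullet> (P *v x)" by (metis P(2) matrix_vector_mul_assoc s)
      then show ?thesis
        by (simp add: matrix_vector_mult_diff_rdistrib inner_diff inner_commute)
    qed
    ultimately have e: "x \<bullet> (N *v x) = (P *v x) \<bullet> (G *v (P *v x)) + (x - P *v x) \<bullet> (x - P *v x)"
      by (simp add: N_def matrix_vector_mult_add_rdistrib inner_add_right)
    show ?thesis
    proof (cases "P *v x = 0")
      case True then show ?thesis using that e by simp
    next
      case False
      then show ?thesis using e Sym_posD(2)[OF G] inner_ge_zero[of "x - P *v x"]
        by (metis add_pos_nonneg)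
    qed
  qed
  then have inv: "invertible N" by (rule invertible_if_definite)
  note N = matrix_inv_mult[OF inv]
  have NP: "N ** P = A" "P ** N = A"
    by (simp_all add: N_def matrix_add_ldistrib matrix_add_rdistrib matrix_diff_ldistrib
        matrix_diff_rdistrib P PA)
  define B where "B = matrix_inv N ** P"
  have B': "B = P ** matrix_inv N"
  proof -
    have "matrix_inv N ** P = matrix_inv N ** (P ** N) ** matrix_inv N"
      using N by (simp flip: matrix_mul_assoc)
    also have "\<dots> = matrix_inv N ** (N ** P) ** matrix_inv N" by (simp add: NP)
    also have "\<dots> = P ** matrix_inv N" using N by (simp add: matrix_mul_assoc)
    finally show ?thesis by (simp add: B_def)
  qed
  have AB: "A ** B = P"
  proof -
    have "A ** B = P ** (N ** matrix_inv N) ** P" by (simp add: B_def NP(2)[symmetric] matrix_mul_assoc)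
    then show ?thesis using N P by simp
  qed
  have BA: "B ** A = P"
  proof -
    have "B ** A = P ** (matrix_inv N ** N) ** P" unfolding B' by (simp add: NP(1)[symmetric] matrix_mul_assoc)
    then show ?thesis using N P by simp
  qed
  have PB: "P ** B = B" unfolding B' using P by (simp add: matrix_mul_assoc)
  have BP: "B ** P = B" unfolding B_def using P by (simp flip: matrix_mul_assoc)
  have "pinv A = B"
    by (rule pinv_eqI) (simp_all add: AB BA PA PB P)
  then have "J = B" by (simp add: J_def A_def)
  then show "J ** (P ** G ** P) = P" "(P ** G ** P) ** J = P" "P ** J = J" "J ** P = J"
    using AB BA PB BP by (simp_all add: A_def)
qed

section \<open>Norms\<close>

lemma is_normD:
  assumes "is_norm \<nu>"
  shows "0 \<le> \<nu> x" "\<nu> x = 0 \<longleftrightarrow> x = 0" "\<nu> (a *\<^sub>R x) = \<bar>a\<bar> * \<nu> x" "\<nu> (x + y) \<le> \<nu> x + \<nu> y"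
    "\<nu> (- x) = \<nu> x" "\<nu> (x - y) \<le> \<nu> x + \<nu> y" "\<nu> 0 = 0"
proof -
  show *: "0 \<le> \<nu> x" "\<nu> x = 0 \<longleftrightarrow> x = 0" "\<nu> (a *\<^sub>R x) = \<bar>a\<bar> * \<nu> x" "\<nu> (x + y) \<le> \<nu> x + \<nu> y"
    for x y a using assms by (auto simp: is_norm_def)
  show m: "\<nu> (- x) = \<nu> x" for x using *(3)[of "-1" x] by simp
  show "\<nu> (x - y) \<le> \<nu> x + \<nu> y" using *(4)[of x "-y"] m[of y] by simp
  show "\<nu> 0 = 0" using * by blast
qed

lemma is_norm_sum_le:
  assumes "is_norm \<nu>"
  shows "\<nu> (sum f A) \<le> (\<Sum>a\<in>A. \<nu> (f a))"
proof (induction A rule: infinite_finite_induct)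
  case (insert a A)
  then show ?case using is_normD(4)[OF assms, of "f a" "sum f A"] by simp
qed (simp_all add: is_normD(7)[OF assms])

lemma is_norm_upper:
  fixes \<nu> :: "'a::euclidean_space \<Rightarrow> real"
  assumes "is_norm \<nu>"
  obtains C where "0 \<le> C" "\<And>x. \<nu> x \<le> C * norm x"
proof
  let ?C = "\<Sum>b\<in>Basis. \<nu> b"
  show "0 \<le> ?C" by (intro sum_nonneg is_normD(1)[OF assms])
  show "\<nu> x \<le> ?C * norm x" for x
  proof -
    have "\<nu> x = \<nu> (\<Sum>b\<in>Basis. (x \<bullet> b) *\<^sub>R b)" by (simp add: euclidean_representation)
    also have "\<dots> \<le> (\<Sum>b\<in>Basis. \<nu> ((x \<bullet> b) *\<^sub>R b))" by (rule is_norm_sum_le[OF assms])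
    also have "\<dots> = (\<Sum>b\<in>Basis. \<bar>x \<bullet> b\<bar> * \<nu> b)" by (simp add: is_normD(3)[OF assms])
    also have "\<dots> \<le> (\<Sum>b\<in>Basis. norm x * \<nu> b)"
      by (intro sum_mono mult_right_mono is_normD(1)[OF assms]) (rule Basis_le_norm)
    finally show ?thesis by (simp add: sum_distrib_left mult.commute)
  qed
qed

lemma is_norm_continuous:
  fixes \<nu> :: "'a::euclidean_space \<Rightarrow> real"
  assumes "is_norm \<nu>"
  shows "continuous_on S \<nu>"
proof -
  obtain C where C: "0 \<le> C" "\<And>x. \<nu> x \<le> C * norm x" using is_norm_upper[OF assms] by blast
  have *: "\<nu> x - \<nu> y \<le> C * norm (x - y)" for x y
    using is_normD(4)[OF assms, of "x - y" y] C(2)[of "x - y"] by simp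
  have "C-lipschitz_on S \<nu>"
  proof (rule lipschitz_onI[OF _ C(1)])
    fix x y
    show "dist (\<nu> x) (\<nu> y) \<le> C * dist x y"
      using *[of x y] *[of y x] by (simp add: dist_norm norm_minus_commute abs_le_iff)
  qed
  then show ?thesis by (rule lipschitz_on_continuous_on)
qed

lemma is_norm_lower:
  fixes \<nu> :: "'a::euclidean_space \<Rightarrow> real"
  assumes "is_norm \<nu>"
  obtains c where "0 < c" "\<And>x. c * norm x \<le> \<nu> x"
proof -
  let ?S = "sphere (0::'a) 1"
  have "?S \<noteq> {}" by simp
  then obtain w where w: "w \<in> ?S" "\<And>x. x \<in> ?S \<Longrightarrow> \<nu> w \<le> \<nu> x"
    using continuous_attains_inf[OF compact_sphere _ is_norm_continuous[OF assms]] by blast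
  have "w \<noteq> 0" using w(1) by auto
  then have "0 < \<nu> w" using is_normD(1,2)[OF assms, of w] by linarith
  moreover have "\<nu> w * norm x \<le> \<nu> x" for x
  proof (cases "x = 0")
    case False
    then have "\<nu> w \<le> \<nu> (x /\<^sub>R norm x)" by (intro w(2)) simp
    also have "\<dots> = \<nu> x / norm x" by (simp add: is_normD(3)[OF assms] divide_inverse mult.commute)
    finally show ?thesis using False by (simp add: field_simps)
  qed (simp add: is_normD(1)[OF assms])
  ultimately show thesis using that by blast
qed

lemma op_norm_bound:
  fixes A :: "real^'n^'n"
  assumes "is_norm \<nu>"
  shows "\<nu> (A *v x) \<le> op_norm \<nu> A * \<nu> x" "0 \<le> op_norm \<nu> A"
proof -
  obtain C where C: "0 \<le> C" "\<And>x. \<nu> x \<le> C * norm x" using is_norm_upper[OF assms] by blast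
  obtain c where c: "0 < c" "\<And>x. c * norm x \<le> \<nu> x" using is_norm_lower[OF assms] by blast
  have up: "\<nu> (A *v x) \<le> C * (onorm ((*v) A) / c)" if "\<nu> x \<le> 1" for x
  proof -
    have "c * norm x \<le> 1" using c(2)[of x] that by linarith
    then have x: "norm x \<le> 1 / c" using c(1) by (simp add: pos_le_divide_eq mult.commute)
    have "norm (A *v x) \<le> onorm ((*v) A) * norm x"
      by (rule onorm[OF matrix_vector_mul_bounded_linear])
    also have "\<dots> \<le> onorm ((*v) A) * (1 / c)"
      by (rule mult_left_mono[OF x onorm_pos_le[OF matrix_vector_mul_bounded_linear]])
    finally have "C * norm (A *v x) \<le> C * (onorm ((*v) A) / c)"
      using C(1) by (intro mult_left_mono) auto
    then show ?thesis using C(2)[of "A *v x"] by linarith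
  qed
  have bdd: "bdd_above {\<nu> (A *v x) |x. \<nu> x \<le> 1}"
    by (rule bdd_aboveI[where M = "C * (onorm ((*v) A) / c)"]) (use up in blast)
  have le: "\<nu> (A *v x) \<le> op_norm \<nu> A" if "\<nu> x \<le> 1" for x
    unfolding op_norm_def by (rule cSup_upper[OF _ bdd]) (use that in blast)
  show "0 \<le> op_norm \<nu> A" using le[of 0] by (simp add: is_normD(7)[OF assms])
  show "\<nu> (A *v x) \<le> op_norm \<nu> A * \<nu> x"
  proof (cases "x = 0")
    case False
    then have pos: "0 < \<nu> x" using is_normD(1,2)[OF assms, of x] by linarith
    have "\<nu> (A *v (x /\<^sub>R \<nu> x)) \<le> op_norm \<nu> A"
      by (rule le) (use pos in \<open>simp add: is_normD(3)[OF assms]\<close>)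
    then show ?thesis using pos
      by (simp add: is_normD(3)[OF assms] matrix_vector_mult_scaleR field_simps)
  qed (simp add: is_normD(7)[OF assms])
qed

text \<open>
  A hyperplane separating \<open>y\<close> from the open ball of radius \<open>\<nu> y\<close>,
  suitably scaled.
\<close>

lemma norming_functional:
  fixes \<nu> :: "'a::euclidean_space \<Rightarrow> real"
  assumes \<nu>: "is_norm \<nu>"
  obtains a where "a \<bullet> y = \<nu> y" "\<And>x. a \<bullet> x \<le> \<nu> x"
proof (cases "y = 0")
  case True
  then show thesis using that[of 0] is_normD[OF \<nu>] by simp
next
  case False
  then have y: "0 < \<nu> y" using is_normD(1,2)[OF \<nu>, of y] by linarith
  let ?S = "{x. \<nu> x < \<nu> y}"
  have "convex ?S"
  proof (rule convexI)
    fix x z u v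
    assume *: "x \<in> ?S" "z \<in> ?S" "(0::real) \<le> u" "0 \<le> v" "u + v = 1"
    have "\<nu> (u *\<^sub>R x + v *\<^sub>R z) \<le> u * \<nu> x + v * \<nu> z"
      using is_normD(4)[OF \<nu>, of "u *\<^sub>R x" "v *\<^sub>R z"] * by (simp add: is_normD(3)[OF \<nu>])
    also have "\<dots> < \<nu> y" using * by (intro convex_bound_lt) auto
    finally show "u *\<^sub>R x + v *\<^sub>R z \<in> ?S" by simp
  qed
  moreover have "0 \<in> ?S" using y by (simp add: is_normD(7)[OF \<nu>])
  ultimately obtain a b where ab: "a \<noteq> 0" "\<forall>x\<in>?S. a \<bullet> x \<le> b" "b \<le> a \<bullet> y"
    using separating_hyperplane_sets[of ?S "{y}"] by auto
  have le: "(a \<bullet> x) * \<nu> y \<le> (a \<bullet> y) * \<nu> x" for x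
  proof (rule field_le_mult_one_interval)
    fix s :: real assume s: "0 < s" "s < 1"
    show "s * ((a \<bullet> x) * \<nu> y) \<le> (a \<bullet> y) * \<nu> x"
    proof (cases "x = 0")
      case False
      then have x: "0 < \<nu> x" using is_normD(1,2)[OF \<nu>, of x] by linarith
      have "(s * \<nu> y / \<nu> x) *\<^sub>R x \<in> ?S" using s x y by (simp add: is_normD(3)[OF \<nu>])
      then have "a \<bullet> ((s * \<nu> y / \<nu> x) *\<^sub>R x) \<le> a \<bullet> y" using ab by (meson order.trans)
      then show ?thesis using x by (simp add: field_simps)
    qed (simp add: is_normD(7)[OF \<nu>])
  qed
  have ay: "0 < a \<bullet> y"
  proof -
    have "0 < (a \<bullet> a) * \<nu> y" using ab y by simp
    also have "\<dots> \<le> (a \<bullet> y) * \<nu> a" by (rule le)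
    finally show ?thesis using is_normD(1)[OF \<nu>, of a] by (simp add: zero_less_mult_iff)
  qed
  show thesis
  proof (rule that[of "(\<nu> y / (a \<bullet> y)) *\<^sub>R a"])
    show "((\<nu> y / (a \<bullet> y)) *\<^sub>R a) \<bullet> y = \<nu> y" using ay by simp
    show "((\<nu> y / (a \<bullet> y)) *\<^sub>R a) \<bullet> x \<le> \<nu> x" for x using le[of x] ay by (simp add: field_simps)
  qed
qed

section \<open>A strict triangle inequality for a projected Neumann series\<close>

text \<open>
  The span of the orbit of \<open>y\<close> is mapped into itself; if the map is injective
  there, it is onto, so \<open>y\<close> itself is a combination of its later iterates.
\<close>

lemma span_powers_shift:
  fixes f :: "'a::euclidean_space \<Rightarrow> 'a"
  assumes f: "linear f"
    and inj: "\<And>z. z \<in> span (range (\<lambda>k. (f ^^ k) y)) \<Longrightarrow> f z = 0 \<Longrightarrow> z = 0"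
  shows "y \<in> span (range (\<lambda>k. (f ^^ Suc k) y))"
proof -
  let ?W = "span (range (\<lambda>k. (f ^^ k) y))"
  have "f ` ?W = span (f ` range (\<lambda>k. (f ^^ k) y))" using linear_span_image[OF f] by metis
  also have "f ` range (\<lambda>k. (f ^^ k) y) = range (\<lambda>k. (f ^^ Suc k) y)" by (auto simp: image_image)
  finally have im: "f ` ?W = span (range (\<lambda>k. (f ^^ Suc k) y))" .
  have "inj_on f ?W"
    using linear_injective_on_subspace_0[OF f subspace_span] inj by blast
  then have "dim (f ` ?W) = dim ?W" using dim_image_eq[OF f, of ?W] by (simp add: span_span)
  moreover have "f ` ?W \<subseteq> ?W"
    unfolding im by (intro span_mono) blast
  ultimately have "f ` ?W = ?W"
    using subspace_dim_equal[of "f ` ?W" ?W] linear_subspace_image[OF f subspace_span] by auto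
  moreover have "y \<in> ?W" by (rule span_base) (metis funpow_0 rangeI)
  ultimately show ?thesis using im by blast
qed

text \<open>
  Here \<open>R = T y + T\<^sup>2 y + \<dots>\<close>, and \<open>k = r \<nu> y / (1 -
  r)\<close> is the sum of the bounds \<open>r\<^sup>n \<nu> y\<close> on the norms of its
  terms. The triangle inequality alone gives the conclusion with \<open>\<le>\<close>. If
  equality held, the functional \<open>g = - a \<circ> Q\<close>, with \<open>a\<close> norming
  \<open>y\<close>, would attain the bound on every term, so that \<open>g \<circ> T = r
  g\<close> on the span of \<open>T y, T\<^sup>2 y, \<dots>\<close>. As \<open>y\<close> belongs
  to this span, \<open>g y = q \<nu> y > 0\<close>, while \<open>Q y = y\<close> gives \<open>g
  y = - \<nu> y < 0\<close>.
\<close>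

lemma perturbed_projection_norm:
  fixes \<nu> :: "real^'n \<Rightarrow> real" and Q :: "real^'n^'n"
  assumes \<nu>: "is_norm \<nu>" and T: "linear T" and Tr: "\<And>x. \<nu> (T x) \<le> r * \<nu> x"
    and r: "0 < r" "r < 1"
    and R: "R = T (y + R)"
    and y: "y \<in> span (range (\<lambda>k. (T ^^ Suc k) y))" "\<nu> y \<noteq> 0"
    and Q: "Q *v y = y" "\<And>x. \<nu> (Q *v x) \<le> q * \<nu> x"
  shows "\<nu> y - q * (r * \<nu> y / (1 - r)) < \<nu> (y + Q *v R)"
proof (rule ccontr)
  define k where "k = r * \<nu> y / (1 - r)"
  have k: "k = r * (\<nu> y + k)" using r by (simp add: k_def field_simps)
  have y0: "0 < \<nu> y" using y(2) is_normD(1)[OF \<nu>, of y] by linarith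
  have q: "0 < q"
    using Q(2)[of y] y0 Q(1) by (smt (verit) mult_nonpos_nonneg)
  assume "\<not> ?thesis"
  then have small: "\<nu> (y + Q *v R) \<le> \<nu> y - q * k" by (simp add: k_def)
  obtain a where a: "a \<bullet> y = \<nu> y" "\<And>x. a \<bullet> x \<le> \<nu> x"
    using norming_functional[OF \<nu>] by blast
  define g where "g x = - (a \<bullet> (Q *v x))" for x
  have g: "linear g"
    unfolding g_def by (rule linearI)
      (simp_all add: matrix_vector_right_distrib matrix_vector_mult_scaleR inner_add_right)
  have gle: "g x \<le> q * \<nu> x" for x
    using a(2)[of "- (Q *v x)"] Q(2)[of x] by (simp add: g_def is_normD(5)[OF \<nu>])
  have Tn: "\<nu> ((T ^^ n) x) \<le> r ^ n * \<nu> x" for n x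
  proof (induction n)
    case (Suc n)
    have "\<nu> ((T ^^ Suc n) x) \<le> r * \<nu> ((T ^^ n) x)" using Tr by simp
    also have "\<dots> \<le> r * (r ^ n * \<nu> x)" using Suc r by (intro mult_left_mono) auto
    finally show ?case by (simp add: mult_ac)
  qed simp
  \<comment> \<open>\<open>k\<close> solves the equation that bounds \<open>\<nu> R\<close>; thus \<open>r\<^sup>n k\<close> bounds the tail of the series after \<open>n\<close> terms\<close>
  have R_le: "\<nu> R \<le> k"
  proof -
    have "\<nu> R \<le> r * (\<nu> y + \<nu> R)"
    proof -
      have "\<nu> R \<le> r * \<nu> (y + R)" using Tr[of "y + R"] R by simp
      also have "\<dots> \<le> r * (\<nu> y + \<nu> R)"
        using is_normD(4)[OF \<nu>, of y R] r by (intro mult_left_mono) auto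
      finally show ?thesis .
    qed
    then show ?thesis using r by (simp add: k_def field_simps)
  qed
  have linT: "linear (T ^^ n)" for n 
  proof (induction n)
    case (Suc n)
    then show ?case using linear_compose[OF Suc T] by (simp add: comp_def)
  qed (simp add: linear_ident)
  have unfold: "(T ^^ n) R = (T ^^ Suc n) y + (T ^^ Suc n) R" for n
  proof -
    have "(T ^^ n) R = (T ^^ n) (T (y + R))" using R by simp
    also have "\<dots> = (T ^^ Suc n) (y + R)" by (simp add: funpow_swap1)
    finally show ?thesis using linear_add[OF linT] by metis
  qed
  have step: "q * r ^ n * k \<le> g ((T ^^ n) R) \<Longrightarrow>
      g ((T ^^ Suc n) y) = q * r ^ Suc n * \<nu> y \<and> q * r ^ Suc n * k \<le> g ((T ^^ Suc n) R)" for n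
  proof -
    assume n: "q * r ^ n * k \<le> g ((T ^^ n) R)"
    have "g ((T ^^ n) R) = g ((T ^^ Suc n) y) + g ((T ^^ Suc n) R)"
      unfolding unfold[of n] by (rule linear_add[OF g])
    moreover have "g ((T ^^ Suc n) y) \<le> q * r ^ Suc n * \<nu> y"
      unfolding mult.assoc using q
      by (intro order.trans[OF gle mult_left_mono[OF Tn]]) simp
    moreover have "g ((T ^^ Suc n) R) \<le> q * r ^ Suc n * k"
    proof -
      have "\<nu> ((T ^^ Suc n) R) \<le> r ^ Suc n * k"
        using r by (intro order.trans[OF Tn mult_left_mono[OF R_le]]) simp
      then show ?thesis
        unfolding mult.assoc using q by (intro order.trans[OF gle mult_left_mono]) auto
    qed
    moreover have "q * r ^ n * k = q * r ^ Suc n * \<nu> y + q * r ^ Suc n * k"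
      by (subst (1) k) (simp add: algebra_simps)
    ultimately show ?thesis using n by linarith
  qed
  have "q * r ^ 0 * k \<le> g ((T ^^ 0) R)"
    using a(2)[of "y + Q *v R"] small a(1) by (simp add: g_def inner_add_right)
  then have all: "q * r ^ n * k \<le> g ((T ^^ n) R)" for n
    by (induction n) (use step in blast)+
  then have val: "g ((T ^^ Suc n) y) = q * r ^ Suc n * \<nu> y" for n using step by blast
  have "g (T y) - r * g y = 0"
  proof (rule span_induct[OF y(1), of "\<lambda>x. g (T x) - r * g x = 0"])
    show "subspace {x. g (T x) - r * g x = 0}"
      by (auto simp: subspace_def linear_0[OF T] linear_0[OF g] linear_add[OF T] linear_add[OF g]
          linear_scale[OF T] linear_scale[OF g] algebra_simps)
    fix x assume "x \<in> range (\<lambda>k. (T ^^ Suc k) y)"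
    then obtain n where "x = (T ^^ Suc n) y" by blast
    then have "g (T x) = q * r ^ Suc (Suc n) * \<nu> y" "g x = q * r ^ Suc n * \<nu> y"
      using val[of "Suc n"] val[of n] by auto
    then show "g (T x) - r * g x = 0" by simp
  qed
  moreover have "g (T y) = q * r * \<nu> y" using val[of 0] by simp
  ultimately have "g y = q * \<nu> y" using r by simp
  moreover have "g y = - \<nu> y" using Q(1) a(1) by (simp add: g_def)
  ultimately show False using mult_pos_pos[OF q y0] y0 by linarith
qed

section \<open>Atomic norms\<close>

lemma atomic_norm_ge: "i \<in> {1..N} \<Longrightarrow> v i \<bullet> x \<le> atomic_norm N v x"
  unfolding atomic_norm_def by (intro Max_ge) auto

lemma atoms_nonempty:
  assumes "atoms N v"
  shows "1 \<in> {1..N}"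
proof (rule ccontr)
  assume "1 \<notin> {1..N}"
  then have "{1..N} = {}" by auto
  then show False using assms by (simp add: atoms_def)
qed

lemma active_nonempty:
  assumes "atoms N v"
  obtains i where "i \<in> active N v x"
proof -
  have "atomic_norm N v x \<in> (\<lambda>i. v i \<bullet> x) ` {1..N}"
    unfolding atomic_norm_def using atoms_nonempty[OF assms] by (intro Max_in) auto
  then show thesis using that by (auto simp: active_def)
qed

text \<open>
  A ball around the origin lies in the convex hull of the atoms, and the atomic norm is the
  support function of that hull.
\<close>

lemma atomic_norm_lower:
  fixes v :: "nat \<Rightarrow> real^'m"
  assumes "atoms N v"
  obtains c where "0 < c" "\<And>x. c * norm x \<le> atomic_norm N v x"
proof -
  obtain e where e: "0 < e" "cball 0 e \<subseteq> convex hull (v ` {1..N})"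
    using assms by (auto simp: atoms_def mem_interior_cball)
  have "e * norm x \<le> atomic_norm N v x" for x
  proof -
    define z where "z = (e / norm x) *\<^sub>R x"
    have "z \<in> cball 0 e" using e(1) by (auto simp: z_def)
    then have "z \<in> convex hull (v ` {1..N})" using e(2) by blast
    moreover have "convex hull (v ` {1..N}) \<subseteq> {z. x \<bullet> z \<le> atomic_norm N v x}"
    proof (rule hull_minimal)
      show "v ` {1..N} \<subseteq> {z. x \<bullet> z \<le> atomic_norm N v x}"
        using atomic_norm_ge[of _ N v x] by (auto simp: inner_commute[of x] simp del: atLeastAtMost_iff)
    qed (rule convex_halfspace_le)
    ultimately have "x \<bullet> z \<le> atomic_norm N v x" by blast
    moreover have "x \<bullet> z = e * norm x"
      by (simp add: z_def power2_norm_eq_inner[symmetric] power2_eq_square)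
    ultimately show ?thesis by simp
  qed
  then show thesis using that e(1) by blast
qed

lemma atomic_norm_scale:
  assumes "0 \<le> t" "atoms N v"
  shows "atomic_norm N v (t *\<^sub>R x) = t * atomic_norm N v x"
proof -
  have "mono ((*) t)" using assms(1) by (simp add: mono_def mult_left_mono)
  then have "t * Max ((\<lambda>i. v i \<bullet> x) ` {1..N}) = Max ((*) t ` (\<lambda>i. v i \<bullet> x) ` {1..N})"
    using atoms_nonempty[OF assms(2)] by (intro mono_Max_commute) auto
  then show ?thesis by (simp add: atomic_norm_def image_image)
qed

text \<open>
  Homogeneity reduces the inequality to the unit ball of the atomic norm, which is bounded, so
  that the supremum in the dual gauge is a bound.
\<close>

lemma dual_gauge_le_1_iff:
  fixes v :: "nat \<Rightarrow> real^'m"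
  assumes "atoms N v"
  shows "dual_gauge N v g \<le> 1 \<longleftrightarrow> (\<forall>x. g \<bullet> x \<le> atomic_norm N v x)"
proof
  obtain c where c: "0 < c" "\<And>x. c * norm x \<le> atomic_norm N v x"
    using atomic_norm_lower[OF assms] by blast
  have "atomic_norm N v 0 \<le> 1" using atomic_norm_scale[of 0 N v 0] assms by simp
  then have ne: "{x \<bullet> g |x. atomic_norm N v x \<le> 1} \<noteq> {}" by blast
  {
    assume le: "dual_gauge N v g \<le> 1"
    have "bdd_above {x \<bullet> g |x. atomic_norm N v x \<le> 1}"
    proof (rule bdd_aboveI[where M = "1 / c * norm g"])
      fix s assume "s \<in> {x \<bullet> g |x. atomic_norm N v x \<le> 1}"
      then obtain x where x: "s = x \<bullet> g" "atomic_norm N v x \<le> 1" by blast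
      then have "norm x \<le> 1 / c" using c(2)[of x] c(1) by (simp add: field_simps)
      then show "s \<le> 1 / c * norm g"
        using norm_cauchy_schwarz[of x g] x by (meson mult_right_mono norm_ge_zero order.trans)
    qed
    then have 1: "x \<bullet> g \<le> 1" if "atomic_norm N v x \<le> 1" for x
      using le that cSup_upper[of "x \<bullet> g" "{x \<bullet> g |x. atomic_norm N v x \<le> 1}"]
      unfolding dual_gauge_def by (metis (mono_tags, lifting) mem_Collect_eq order.trans)
    show "\<forall>x. g \<bullet> x \<le> atomic_norm N v x"
    proof
      fix x
      show "g \<bullet> x \<le> atomic_norm N v x"
      proof (cases "x = 0")
        case True
        then show ?thesis using c(2)[of 0] by simp
      next
        case False
        define t where "t = atomic_norm N v x"
        have "0 < c * norm x" using c(1) False by simp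
        then have t: "0 < t" using c(2)[of x] unfolding t_def by linarith
        have "atomic_norm N v ((1 / t) *\<^sub>R x) = (1 / t) * t"
          using atomic_norm_scale[of "1 / t" N v x] t assms by (simp add: t_def)
        then have "((1 / t) *\<^sub>R x) \<bullet> g \<le> 1" using t by (intro 1) simp
        then show ?thesis using t by (simp add: t_def[symmetric] field_simps inner_commute)
      qed
    qed
  }
  assume "\<forall>x. g \<bullet> x \<le> atomic_norm N v x"
  then show "dual_gauge N v g \<le> 1"
    unfolding dual_gauge_def using ne
    by (intro cSup_least) (auto simp: inner_commute intro: order.trans)
qed

lemma subspace_patt_space: "subspace (patt_space v I)"
proof (rule subspaceI)
  show "0 \<in> patt_space v I" by (simp add: patt_space_def)
  fix x y and c :: real
  assume x: "x \<in> patt_space v I"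
  then show "c *\<^sub>R x \<in> patt_space v I"
    unfolding patt_space_def mem_Collect_eq inner_scaleR_right by metis
  assume "y \<in> patt_space v I"
  then show "x + y \<in> patt_space v I"
    using x unfolding patt_space_def mem_Collect_eq inner_add_right by metis
qed

lemma active_patt_space: "x \<in> patt_space v (active N v x)"
  by (simp add: patt_space_def active_def)

lemma face_proj:
  assumes "i \<in> I"
  shows "face_proj v I \<in> patt_space v I"
    "x \<in> patt_space v I \<Longrightarrow> face_proj v I \<bullet> x = v i \<bullet> x"
proof -
  note P = proj_matrix_spec[OF subspace_patt_space[of v I]]
    and P' = proj_matrix_props[OF subspace_patt_space[of v I]]
  show "face_proj v I \<in> patt_space v I" unfolding face_proj_def by (rule P)
  assume x: "x \<in> patt_space v I"
  have "(SOME i. i \<in> I) \<in> I" by (rule someI[of _ i]) (rule assms)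
  then have "v (SOME i. i \<in> I) \<bullet> x = v i \<bullet> x" using x assms unfolding patt_space_def by blast
  moreover have "face_proj v I \<bullet> x = v (SOME i. i \<in> I) \<bullet> x"
    unfolding face_proj_def inner_symmetric[OF P'(2)] P'(1)[OF x] ..
  ultimately show "face_proj v I \<bullet> x = v i \<bullet> x" by simp
qed

text \<open>
  On the pattern space the face projection acts like any active atom, and every atom is bounded
  by the atomic norm.
\<close>

lemma dual_gauge_on_face_proj:
  assumes at: "atoms N v" and i: "i \<in> active N v z"
  shows "dual_gauge_on N v (active N v z) (face_proj v (active N v z)) \<le> 1"
  unfolding dual_gauge_on_def
proof (rule cSup_least)
  let ?I = "active N v z"
  have "0 \<in> patt_space v ?I" using subspace_0[OF subspace_patt_space] .
  moreover have "atomic_norm N v 0 \<le> 1" using atomic_norm_scale[of 0 N v 0] at by simp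
  ultimately show "{x \<bullet> face_proj v ?I |x. x \<in> patt_space v ?I \<and> atomic_norm N v x \<le> 1} \<noteq> {}"
    by blast
  fix s assume "s \<in> {x \<bullet> face_proj v ?I |x. x \<in> patt_space v ?I \<and> atomic_norm N v x \<le> 1}"
  then obtain x where x: "s = x \<bullet> face_proj v ?I" "x \<in> patt_space v ?I" "atomic_norm N v x \<le> 1"
    by blast
  then have "s = v i \<bullet> x" using face_proj(2)[OF i x(2)] by (simp add: inner_commute)
  also have "\<dots> \<le> atomic_norm N v x" using i by (intro atomic_norm_ge) (simp add: active_def)
  finally show "s \<le> 1" using x(3) by simp
qed

text \<open>
  Equal patterns are equal convex hulls and say nothing directly about indices. The atom
  \<open>v i\<close> lies in the hull of the atoms active at \<open>x\<close>, all of which take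
  the value \<open>atomic_norm N v x\<close> at \<open>x\<close>.
\<close>

lemma active_if_patt_eq:
  assumes "patt N v x = patt N v y" "i \<in> active N v y"
  shows "v i \<bullet> x = atomic_norm N v x"
proof -
  have "v i \<in> convex hull (v ` active N v y)" using assms(2) by (intro hull_inc) auto
  then have "v i \<in> convex hull (v ` active N v x)"
    using assms(1) by (simp add: patt_def subdiff_def)
  moreover have "convex hull (v ` active N v x) \<subseteq> {g. x \<bullet> g = atomic_norm N v x}"
  proof (rule hull_minimal)
    show "v ` active N v x \<subseteq> {g. x \<bullet> g = atomic_norm N v x}"
    proof
      fix g assume "g \<in> v ` active N v x"
      then obtain j where "g = v j" "v j \<bullet> x = atomic_norm N v x" unfolding active_def by blast
      then show "g \<in> {g. x \<bullet> g = atomic_norm N v x}" by (simp add: inner_commute[of x])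
    qed
  qed (rule convex_hyperplane)
  ultimately have "x \<bullet> v i = atomic_norm N v x" by blast
  then show ?thesis by (simp add: inner_commute[of x])
qed

section \<open>Perturbation of the precision matrix\<close>

text \<open>
  An eigenvector \<open>u\<close> of \<open>B\<close> gives the eigenvector \<open>u
  u\<^sup>T\<close> of right multiplication by \<open>B\<^sup>T\<close>, which is the map with
  matrix \<open>B \<otimes> 1\<close>.
\<close>

lemma eigenvalue_le_op_norm:
  fixes B :: "real^'n^'n"
  assumes \<nu>: "is_norm \<nu>" and u: "u \<noteq> 0" "B *v u = m *\<^sub>R u"
  shows "\<bar>m\<bar> \<le> op_norm \<nu> (kron B (mat 1 :: real^'n^'n))"
proof -
  define W where "W = (\<chi> a b. u $ a * u $ b)"
  have "W ** transpose B = m *\<^sub>R W"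
  proof -
    have "(\<Sum>k\<in>UNIV. u $ a * u $ k * B $ b $ k) = u $ a * (B *v u) $ b" for a b
      by (simp add: matrix_vector_mult_def sum_distrib_left mult_ac)
    then show ?thesis
      by (simp add: W_def vec_eq_iff matrix_matrix_mult_def transpose_def u(2) mult_ac)
  qed
  then have "kron B (mat 1) *v vec_col W = m *\<^sub>R vec_col W"
    by (simp add: kron_vec_col vec_col_scaleR)
  then have le: "\<bar>m\<bar> * \<nu> (vec_col W) \<le> op_norm \<nu> (kron B (mat 1)) * \<nu> (vec_col W)"
    using op_norm_bound(1)[OF \<nu>, of "kron B (mat 1)" "vec_col W"] by (simp add: is_normD(3)[OF \<nu>])
  obtain a where "u $ a \<noteq> 0" using u(1) by (auto simp: vec_eq_iff)
  then have "W $ a $ a \<noteq> 0" by (simp add: W_def)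
  then have "W \<noteq> 0" by auto
  then have "vec_col W \<noteq> 0" by (metis vec_col_0 vec_col_eq_iff)
  then have "0 < \<nu> (vec_col W)" using is_normD(1,2)[OF \<nu>, of "vec_col W"] by linarith
  then show ?thesis using le by simp
qed

text \<open>
  The eigenvalues of \<open>\<Delta>\<close> relative to \<open>\<Sigma>\<inverse>\<close> are
  those of \<open>\<Sigma> \<Delta>\<close>, and the operator norm bounds their absolute values;
  hence they are larger than \<open>- 1\<close>.
\<close>

lemma perturbation_Sym_pos:
  fixes \<Sigma> \<Delta> :: "real^'n^'n"
  assumes \<nu>: "is_norm \<nu>" and \<Sigma>: "\<Sigma> \<in> Sym_pos" and \<Delta>: "\<Delta> \<in> Sym"
    and lt1: "op_norm \<nu> (kron (\<Sigma> ** \<Delta>) (mat 1 :: real^'n^'n)) < 1"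
  shows "matrix_inv \<Sigma> + \<Delta> \<in> Sym_pos"
proof -
  define K where "K = matrix_inv \<Sigma>"
  have K: "K \<in> Sym_pos" and \<Sigma>K: "\<Sigma> ** K = mat 1"
    using matrix_inv_pos[OF \<Sigma>] matrix_inv_mult[OF matrix_inv_pos(1)[OF \<Sigma>]] by (auto simp: K_def)
  have \<Delta>': "transpose \<Delta> = \<Delta>" using \<Delta> by (simp add: Sym_def)
  obtain C :: "real^'n^'n" and m :: "'n \<Rightarrow> real"
    where C: "invertible C" "transpose C ** K ** C = mat 1"
      and C\<Delta>: "\<And>i j. (transpose C ** \<Delta> ** C) $ i $ j = (if i = j then m i else 0)"
      and col: "\<And>i. \<Delta> *v column i C = m i *\<^sub>R (K *v column i C)"
    using simultaneous_diagonalization[OF K \<Delta>'] by metis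
  have m: "0 < 1 + m i" for i
  proof -
    have "column i C \<noteq> 0" by (rule invertible_column_nonzero[OF C(1)])
    moreover have "(\<Sigma> ** \<Delta>) *v column i C = m i *\<^sub>R column i C"
      using \<Sigma>K by (simp add: col matrix_vector_mult_scaleR matrix_vector_mul_assoc
          flip: matrix_vector_mul_assoc[of \<Sigma> \<Delta>])
    ultimately have "\<bar>m i\<bar> < 1" using eigenvalue_le_op_norm[OF \<nu>] lt1 by (meson order.strict_trans1)
    then show ?thesis by linarith
  qed
  have "0 < x \<bullet> ((K + \<Delta>) *v x)" if "x \<noteq> 0" for x
  proof -
    define z where "z = matrix_inv C *v x"
    have x: "x = C *v z" using matrix_inv_mult[OF C(1)] by (simp add: z_def matrix_vector_mul_assoc)
    then have "z \<noteq> 0" using that by auto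
    then obtain j where j: "z $ j \<noteq> 0" by (auto simp: vec_eq_iff)
    have "x \<bullet> ((K + \<Delta>) *v x) = z \<bullet> ((transpose C ** (K + \<Delta>) ** C) *v z)"
      unfolding x by (metis inner_commute inner_transpose matrix_vector_mul_assoc)
    also have "transpose C ** (K + \<Delta>) ** C = (\<chi> i j. if i = j then 1 + m i else 0)"
      unfolding matrix_add_ldistrib matrix_add_rdistrib C(2)
      by (simp add: vec_eq_iff C\<Delta> mat_def)
    also have "(\<chi> i j. if i = j then 1 + m i else 0) *v z = (\<chi> i. (1 + m i) * z $ i)"
      by (simp add: matrix_vector_mult_def if_distrib[of "\<lambda>c. c * _"] cong: if_cong)
    also have "z \<bullet> (\<chi> i. (1 + m i) * z $ i) = (\<Sum>i\<in>UNIV. (1 + m i) * (z $ i)\<^sup>2)"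
      by (simp add: inner_vec_def power2_eq_square mult_ac)
    also have "\<dots> > 0"
      using m j by (intro sum_pos2[of _ j]) (auto simp: less_imp_le)
    finally show ?thesis .
  qed
  then show ?thesis
    using K \<Delta>' by (simp add: K_def[symmetric] Sym_pos_def Sym_def transpose_add)
qed

text \<open>
  The remainder of the first-order expansion of the inverse equals \<open>- (J - \<Sigma>)
  \<Delta> \<Sigma>\<close> with \<open>J = (\<Sigma>\<inverse> + \<Delta>)\<inverse>\<close>,
  and \<open>vec (J - \<Sigma>) = y + R\<close>. This closed form of the Neumann series makes
  all norm estimates finite computations.
\<close>

lemma inverse_remainder:
  fixes \<Sigma> \<Delta> :: "real^'n^'n"
  assumes \<Sigma>: "\<Sigma> \<in> Sym_pos" and \<Delta>: "\<Delta> \<in> Sym" and inv: "invertible (matrix_inv \<Sigma> + \<Delta>)"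
  defines "y \<equiv> - (kron \<Sigma> \<Sigma> *v vec_col \<Delta>)"
    and "R \<equiv> vec_col (matrix_inv (matrix_inv \<Sigma> + \<Delta>) - \<Sigma>) + kron \<Sigma> \<Sigma> *v vec_col \<Delta>"
  shows "R = - (kron (\<Sigma> ** \<Delta>) (mat 1 :: real^'n^'n) *v (y + R))"
proof -
  define K where "K = matrix_inv \<Sigma>"
  define J where "J = matrix_inv (K + \<Delta>)"
  have t: "transpose \<Sigma> = \<Sigma>" "transpose \<Delta> = \<Delta>"
    using Sym_posD(1)[OF \<Sigma>] \<Delta> by (auto simp: Sym_def)
  have K\<Sigma>: "K ** \<Sigma> = mat 1" using matrix_inv_mult[OF matrix_inv_pos(1)[OF \<Sigma>]] by (simp add: K_def)
  have JH: "J ** (K + \<Delta>) = mat 1" using matrix_inv_mult[OF inv] by (simp add: J_def K_def)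
  have "J + J ** \<Delta> ** \<Sigma> = J ** (K + \<Delta>) ** \<Sigma>"
    using K\<Sigma> by (simp add: matrix_add_ldistrib matrix_add_rdistrib flip: matrix_mul_assoc)
  then have eq: "J + J ** \<Delta> ** \<Sigma> = \<Sigma>" by (simp add: JH)
  have yR: "y + R = vec_col (J - \<Sigma>)" by (simp add: y_def R_def J_def K_def)
  have "R = vec_col (J - \<Sigma> + \<Sigma> ** \<Delta> ** \<Sigma>)"
    by (simp add: R_def J_def K_def kron_vec_col t vec_col_add)
  also have "J - \<Sigma> + \<Sigma> ** \<Delta> ** \<Sigma> = - ((J - \<Sigma>) ** \<Delta> ** \<Sigma>)"
    using eq by (simp add: matrix_diff_rdistrib algebra_simps)
  finally have R: "R = - vec_col ((J - \<Sigma>) ** \<Delta> ** \<Sigma>)" by (simp add: vec_col_minus)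
  have "kron (\<Sigma> ** \<Delta>) (mat 1) *v (y + R) = vec_col ((J - \<Sigma>) ** \<Delta> ** \<Sigma>)"
    unfolding yR by (simp add: kron_vec_col matrix_transpose_mul t matrix_mul_assoc)
  then show ?thesis using R by simp
qed

text \<open>
  The map \<open>T\<close> is right multiplication by \<open>- \<Delta> \<Sigma>\<close>. It is
  injective on the subspace \<open>G\<close>, which contains the iterates of \<open>y\<close>:
  if \<open>Z = \<Sigma> \<Delta> U\<close> is symmetric and \<open>Z \<Delta> \<Sigma> =
  0\<close>, then \<open>Z \<Sigma>\<inverse> Z = Z \<Delta> U = 0\<close>, and \<open>Z =
  0\<close> because \<open>\<Sigma>\<inverse>\<close> is positive definite.
\<close>

lemma derivative_in_Krylov_space:
  fixes \<Sigma> \<Delta> :: "real^'n^'n"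
  assumes \<Sigma>: "\<Sigma> \<in> Sym_pos" and \<Delta>: "\<Delta> \<in> Sym"
  defines "T \<equiv> \<lambda>x. - (kron (\<Sigma> ** \<Delta>) (mat 1 :: real^'n^'n) *v x)"
    and "y \<equiv> - (kron \<Sigma> \<Sigma> *v vec_col \<Delta>)"
  shows "linear T" "y \<in> span (range (\<lambda>k. (T ^^ Suc k) y))"
proof -
  show T: "linear T"
    unfolding T_def by (intro linear_compose_neg matrix_vector_mul_linear)
  have t: "transpose \<Sigma> = \<Sigma>" "transpose \<Delta> = \<Delta>"
    using Sym_posD(1)[OF \<Sigma>] \<Delta> by (auto simp: Sym_def)
  have Tvec: "T (vec_col Z) = vec_col (- (Z ** \<Delta> ** \<Sigma>))" for Z :: "real^'n^'n"
    by (simp add: T_def kron_vec_col matrix_transpose_mul t vec_col_minus matrix_mul_assoc)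
  define G where "G = {Z :: real^'n^'n. transpose Z = Z \<and> Z ** \<Delta> ** \<Sigma> = \<Sigma> ** \<Delta> ** Z \<and>
    (\<exists>U. Z = \<Sigma> ** \<Delta> ** U)}"
  have G: "subspace G"
  proof (rule subspaceI)
    show "0 \<in> G"
      by (auto simp: G_def vec_eq_iff transpose_def matrix_matrix_mult_def intro!: exI[of _ 0])
    fix Z Z' :: "real^'n^'n" and c :: real
    assume Z: "Z \<in> G"
    then show "c *\<^sub>R Z \<in> G"
      by (auto simp: G_def transpose_scalar scalar_matrix_assoc[symmetric] matrix_scalar_ac
          intro: exI[of _ "c *\<^sub>R _"])
    assume "Z' \<in> G"
    then show "Z + Z' \<in> G"
      using Z by (auto simp: G_def transpose_add matrix_add_ldistrib matrix_add_rdistrib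
          simp flip: matrix_add_ldistrib)
  qed
  have gen: "\<exists>Z\<in>G. (T ^^ k) y = vec_col Z" for k
  proof (induction k)
    case 0
    have "y = vec_col (- (\<Sigma> ** \<Delta> ** \<Sigma>))" by (simp add: y_def kron_vec_col t vec_col_minus)
    moreover have "- (\<Sigma> ** \<Delta> ** \<Sigma>) \<in> G"
      by (auto simp: G_def transpose_minus matrix_transpose_mul t matrix_mul_assoc matrix_minus_left
          matrix_minus_right intro: exI[of _ "- \<Sigma>"])
    ultimately show ?case by auto
  next
    case (Suc k)
    then obtain Z where Z: "Z \<in> G" "(T ^^ k) y = vec_col Z" by blast
    then have c: "Z ** \<Delta> ** \<Sigma> = \<Sigma> ** \<Delta> ** Z" and s: "transpose Z = Z" by (auto simp: G_def)
    have "- (Z ** \<Delta> ** \<Sigma>) \<in> G"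
      unfolding G_def mem_Collect_eq
    proof (intro conjI exI)
      show "transpose (- (Z ** \<Delta> ** \<Sigma>)) = - (Z ** \<Delta> ** \<Sigma>)"
        unfolding transpose_minus by (simp add: matrix_transpose_mul t s c matrix_mul_assoc)
      show "- (Z ** \<Delta> ** \<Sigma>) ** \<Delta> ** \<Sigma> = \<Sigma> ** \<Delta> ** - (Z ** \<Delta> ** \<Sigma>)"
        unfolding matrix_minus_left matrix_minus_right by (subst c) (simp only: matrix_mul_assoc)
      show "- (Z ** \<Delta> ** \<Sigma>) = \<Sigma> ** \<Delta> ** (- Z)"
        by (simp add: c matrix_minus_right)
    qed
    then show ?case using Z(2) Tvec[of Z] by auto
  qed
  show "y \<in> span (range (\<lambda>k. (T ^^ Suc k) y))"
  proof (rule span_powers_shift[OF T])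
    fix z assume z: "z \<in> span (range (\<lambda>k. (T ^^ k) y))" and Tz: "T z = 0"
    have "span (range (\<lambda>k. (T ^^ k) y)) \<subseteq> vec_col ` G"
      by (rule span_minimal) (use gen linear_subspace_image[OF linear_vec_col G] in auto)
    then obtain Z U where Z: "z = vec_col Z" "transpose Z = Z" "Z = \<Sigma> ** \<Delta> ** U"
      using z by (auto simp: G_def)
    define K where "K = matrix_inv \<Sigma>"
    have K: "K \<in> Sym_pos" and \<Sigma>K: "\<Sigma> ** K = mat 1" "K ** \<Sigma> = mat 1"
      using matrix_inv_pos[OF \<Sigma>] matrix_inv_mult[OF matrix_inv_pos(1)[OF \<Sigma>]] by (auto simp: K_def)
    have "vec_col (Z ** \<Delta> ** \<Sigma>) = 0" using Tz by (simp add: Z(1) Tvec vec_col_minus)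
    then have 0: "Z ** \<Delta> ** \<Sigma> = 0" by (metis vec_col_0 vec_col_eq_iff)
    have "Z ** K ** Z = Z ** (K ** \<Sigma>) ** \<Delta> ** U"
      by (subst (2) Z(3)) (simp add: matrix_mul_assoc)
    also have "\<dots> = Z ** \<Delta> ** (\<Sigma> ** K) ** U" by (simp add: \<Sigma>K)
    also have "\<dots> = Z ** \<Delta> ** \<Sigma> ** K ** U" by (simp add: matrix_mul_assoc)
    finally have ZKZ: "Z ** K ** Z = 0" by (simp add: 0)
    have "Z *v x = 0" for x
    proof (rule ccontr)
      assume "Z *v x \<noteq> 0"
      then have "0 < (Z *v x) \<bullet> (K *v (Z *v x))" using Sym_posD(2)[OF K] by blast
      also have "\<dots> = x \<bullet> ((Z ** K ** Z) *v x)"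
        by (simp add: inner_symmetric[OF Z(2)] matrix_vector_mul_assoc matrix_mul_assoc)
      finally show False by (simp add: ZKZ)
    qed
    then have "Z = 0" by (simp add: matrix_eq)
    then show "z = 0" by (simp add: Z(1) vec_col_0)
  qed
qed

section \<open>Optimality conditions and the radii \<open>\<tau>\<close> and \<open>\<zeta>\<close>\<close>

text \<open>
  The first-order condition with a subgradient \<open>g\<close> of the atomic norm at
  \<open>Kh\<close>; strictness comes from \<open>ln det\<close>.
\<close>

lemma objective_less:
  fixes Kh L S :: "'p::{card2,linorder} sqmat"
  assumes Kh: "Kh \<in> Sym_pos" and L: "L \<in> Sym_pos" "L \<noteq> Kh" and S: "S \<in> Sym" and l: "0 \<le> l"
    and g: "\<And>x. g \<bullet> x \<le> atomic_norm N v x" "g \<bullet> vec_low Kh = atomic_norm N v (vec_low Kh)"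
    and stat: "vec_col (S - matrix_inv Kh) + l *\<^sub>R (dup *v g) = 0"
  shows "objective N v l S Kh < objective N v l S L"
proof -
  let ?J = "matrix_inv Kh" and ?H = "L - Kh"
  have J: "transpose ?J = ?J" using matrix_inv_pos(2)[OF Kh] by (simp add: Sym_posD)
  have H: "?H \<in> Sym" using Kh L by (simp add: Sym_pos_def Sym_def transpose_diff)
  have "trace (S ** ?H) - trace (?J ** ?H) = vec_col (S - ?J) \<bullet> vec_col ?H"
    using S J by (simp add: inner_vec_col transpose_diff Sym_def matrix_diff_rdistrib trace_sub)
  also have "\<dots> = - l * ((dup *v g) \<bullet> vec_col ?H)"
    using stat by (simp add: eq_neg_iff_add_eq_0[THEN iffD2, OF stat])
  also have "\<dots> = 2 * l * (g \<bullet> vec_low Kh - g \<bullet> vec_low L)"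
    by (simp add: inner_dup[OF H] vec_low_diff inner_diff_right algebra_simps)
  also have "\<dots> \<ge> 2 * l * (atomic_norm N v (vec_low Kh) - atomic_norm N v (vec_low L))"
    using g(1)[of "vec_low L"] g(2) l by (intro mult_left_mono) auto
  finally have "trace (S ** ?H) - trace (?J ** ?H) \<ge> l * pen N v Kh - l * pen N v L"
    by (simp add: pen_def algebra_simps)
  moreover have "trace (S ** ?H) = trace (S ** L) - trace (S ** Kh)"
    by (simp add: matrix_diff_ldistrib trace_sub)
  moreover have "ln (det L) - ln (det Kh) < trace (?J ** ?H)"
    by (rule ln_det_less_trace[OF Kh L])
  ultimately show ?thesis by (simp add: objective_def)
qed

text \<open>
  The supremum \<open>\<tau>\<close> is not assumed to belong to the set that defines it, but
  \<open>s \<pi>\<close> is admissible for every \<open>s < 1\<close>, and the inequality passes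
  to the limit \<open>s \<rightarrow> 1\<close>.
\<close>

lemma tau_dual_gauge:
  assumes at: "atoms N v" and \<nu>: "is_norm \<nu>" and ne: "tau_set \<nu> N v I \<noteq> {}"
    and \<pi>: "\<pi> \<in> orthogonal_comp (patt_space v I)"
    and le: "ereal (\<nu> (dup *v \<pi>)) \<le> tau \<nu> N v I"
  shows "(face_proj v I + \<pi>) \<bullet> x \<le> atomic_norm N v x"
proof -
  have in_set: "face_proj v I \<bullet> x + s * (\<pi> \<bullet> x) \<le> atomic_norm N v x"
    if "t \<in> tau_set \<nu> N v I" "\<nu> (dup *v (s *\<^sub>R \<pi>)) \<le> t" for s t
  proof -
    have "s *\<^sub>R \<pi> \<in> orthogonal_comp (patt_space v I)"
      using subspace_scale[OF subspace_orthogonal_comp \<pi>] .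
    then have "dual_gauge N v (face_proj v I + s *\<^sub>R \<pi>) \<le> 1"
      using that by (auto simp: tau_set_def)
    then show ?thesis using dual_gauge_le_1_iff[OF at] by (metis inner_add_left inner_scaleR_left)
  qed
  show ?thesis
  proof (cases "\<nu> (dup *v \<pi>) = 0")
    case True
    obtain t where t: "t \<in> tau_set \<nu> N v I" using ne by blast
    then have "0 \<le> t" by (simp add: tau_set_def)
    then show ?thesis using in_set[OF t, of 1] True by (simp add: inner_add_left)
  next
    case False
    then have pos: "0 < \<nu> (dup *v \<pi>)" using is_normD(1)[OF \<nu>, of "dup *v \<pi>"] by linarith
    have lt: "face_proj v I \<bullet> x + s * (\<pi> \<bullet> x) \<le> atomic_norm N v x" if s: "0 < s" "s < 1" for s
    proof -
      have e: "\<nu> (dup *v (s *\<^sub>R \<pi>)) = s * \<nu> (dup *v \<pi>)"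
        using s by (simp add: matrix_vector_mult_scaleR is_normD(3)[OF \<nu>])
      have "ereal (s * \<nu> (dup *v \<pi>)) < ereal (\<nu> (dup *v \<pi>))" using s pos by simp
      then have "ereal (s * \<nu> (dup *v \<pi>)) < tau \<nu> N v I" using le by (rule less_le_trans)
      then obtain t where "t \<in> tau_set \<nu> N v I" "s * \<nu> (dup *v \<pi>) < t"
        unfolding tau_def less_Sup_iff by auto
      then show ?thesis using in_set[of t s] e by simp
    qed
    have "(\<pi> \<bullet> x) \<le> atomic_norm N v x - face_proj v I \<bullet> x"
    proof (rule ccontr)
      assume *: "\<not> ?thesis"
      define a where "a = \<pi> \<bullet> x"
      define b where "b = atomic_norm N v x - face_proj v I \<bullet> x"
      have ab: "b < a" and sab: "s * a \<le> b" if "0 < s" "s < 1" for s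
        using * lt[OF that] by (auto simp: a_def b_def)
      have "b < a" using ab[of "1/2"] by simp
      have "((\<lambda>s. s * a) \<longlongrightarrow> 1 * a) (at_left 1)"
        by (intro tendsto_intros)
      moreover have "eventually (\<lambda>s. s * a \<le> b) (at_left (1::real))"
        by (rule eventually_mono[OF eventually_at_left_real[of 0]]) (use sab in auto)
      ultimately have "1 * a \<le> b" by (intro tendsto_upperbound) auto
      then show False using \<open>b < a\<close> by simp
    qed
    then show ?thesis by (simp add: inner_add_left)
  qed
qed

text \<open>
  The set of admissible radii is closed downwards, so every radius strictly below its supremum
  is admissible.
\<close>

lemma zeta_patt_eq:
  assumes \<eta>: "0 < \<eta>" and r: "ereal r \<le> ereal \<eta> * zeta \<nu> N v \<Gamma> K"
    and L: "L \<in> model_space v (active N v (vec_low K))" "\<nu> (\<Gamma> *v vec_col (L - K)) < r / \<eta>"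
  shows "patt_mat N v L = patt_mat N v K"
proof -
  let ?n = "\<nu> (\<Gamma> *v vec_col (L - K))"
  have "ereal ?n < zeta \<nu> N v \<Gamma> K"
  proof (rule ccontr)
    assume "\<not> ?thesis"
    then have "zeta \<nu> N v \<Gamma> K \<le> ereal ?n" by simp
    then have "ereal \<eta> * zeta \<nu> N v \<Gamma> K \<le> ereal \<eta> * ereal ?n"
      using \<eta> by (intro ereal_mult_left_mono) auto
    then have "r \<le> \<eta> * ?n" using r by (metis ereal_less_eq(3) order.trans times_ereal.simps(1))
    then show False using L(2) \<eta> by (simp add: field_simps)
  qed
  then show ?thesis
    using L(1) unfolding zeta_def less_Sup_iff by auto
qed

section \<open>The model space\<close>

lemma subspace_model_space: "subspace (model_space v I)"
  using subspace_patt_space[of v I]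
  by (auto simp: model_space_def subspace_def Sym_def transpose_add transpose_scalar
      vec_low_add vec_low_scaleR linear_0[OF linear_vec_low] transpose_def vec_eq_iff)

lemma sym_of_low_model_space:
  assumes "s \<in> patt_space v I"
  shows "sym_of_low s \<in> model_space v I"
  using assms sym_of_low[of s] by (auto simp: model_space_def Sym_zero_def)

text \<open>
  Diagonal matrices belong to every model space, which forces the diagonal of \<open>Z\<close>
  to vanish.
\<close>

lemma model_space_orthogonal_comp:
  fixes Z :: "'p::{card2,linorder} sqmat"
  assumes Z: "Z \<in> Sym" and ort: "vec_col Z \<in> orthogonal_comp (vec_col ` model_space v I)"
  obtains \<pi> where "\<pi> \<in> orthogonal_comp (patt_space v I)" "vec_col Z = dup *v \<pi>"
proof
  have 0: "vec_col Z \<bullet> vec_col X = 0" if "X \<in> model_space v I" for X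
    using ort that by (auto simp: orthogonal_comp_def orthogonal_def inner_commute)
  have "Z $ i $ i = 0" for i
  proof -
    define E :: "'p sqmat" where "E = (\<chi> a b. if a = i \<and> b = i then 1 else 0)"
    have "vec_low E = 0"
      using Rep_lower_less(3) by (auto simp: E_def vec_low_def vec_eq_iff)
    moreover have "E \<in> Sym" by (auto simp: Sym_def transpose_def E_def vec_eq_iff)
    ultimately have "E \<in> model_space v I"
      using subspace_0[OF subspace_patt_space] by (simp add: model_space_def)
    then have "vec_col Z \<bullet> vec_col E = 0" by (rule 0)
    moreover have "vec_col Z \<bullet> vec_col E = (\<Sum>k\<in>UNIV. if k = (i, i) then Z $ i $ i else 0)"
      unfolding inner_vec_def by (rule sum.cong) (auto simp: vec_col_def E_def)
    ultimately show ?thesis by simp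
  qed
  then have "Z \<in> Sym_zero" using Z by (simp add: Sym_zero_def)
  then have "sym_of_low (vec_low Z) = Z" by (intro Sym_zero_eqI) (simp_all add: sym_of_low)
  then show "vec_col Z = dup *v vec_low Z" by (simp add: dup_vec)
  then have "2 * (vec_low Z \<bullet> s) = 0" if "s \<in> patt_space v I" for s
    using 0[OF sym_of_low_model_space[OF that]] inner_dup[of "sym_of_low s" "vec_low Z"]
      sym_of_low_model_space[OF that] by (simp add: sym_of_low model_space_def)
  then show "vec_low Z \<in> orthogonal_comp (patt_space v I)"
    by (auto simp: orthogonal_comp_def orthogonal_def inner_commute)
qed

section \<open>The stationarity equation on the model space\<close>

text \<open>
  The equation for \<open>\<delta>\<close> says that \<open>vec (S - (\<Sigma>\<inverse> + unvec
  \<delta>)\<inverse>) + d\<close> is orthogonal to \<open>V\<close>; this is stationarity along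
  \<open>V\<close> when \<open>d\<close> represents the penalty. Its right-hand side maps the
  ball \<open>B\<close> into itself, so that Brouwer's theorem applies, and a fixed point on the
  boundary of \<open>B\<close> would turn \<open>perturbed_projection_norm\<close> into a
  contradiction.
\<close>

lemma restricted_stationary_point:
  fixes \<Sigma> S :: "real^'n^'n" and V :: "(real^('n \<times> 'n)) set"
  assumes \<nu>: "is_norm \<nu>" and \<Sigma>: "\<Sigma> \<in> Sym_pos"
    and V: "subspace V" "V \<subseteq> vec_col ` Sym"
    and \<eta>: "0 < \<eta>" "\<And>\<delta>. \<delta> \<in> V \<Longrightarrow>
      op_norm \<nu> (kron (\<Sigma> ** unvec \<delta>) (mat 1 :: real^'n^'n)) \<le> \<eta> * \<nu> (kron \<Sigma> \<Sigma> *v \<delta>)"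
    and \<rho>: "0 < \<rho>" "\<eta> * \<rho> < 1"
  defines "P \<equiv> proj_matrix V" and "\<Gamma> \<equiv> kron \<Sigma> \<Sigma>"
  defines "J \<equiv> pinv (P ** \<Gamma> ** P)"
  defines "R \<equiv> \<lambda>\<delta>. vec_col (matrix_inv (matrix_inv \<Sigma> + unvec \<delta>) - \<Sigma>) + \<Gamma> *v \<delta>"
  assumes bound: "op_norm \<nu> (\<Gamma> ** J) *
      (\<nu> (vec_col (S - \<Sigma>)) + \<nu> d + \<eta> * \<rho> * \<rho> / (1 - \<eta> * \<rho>)) \<le> \<rho>"
  obtains \<delta> where "\<delta> \<in> V" "\<nu> (\<Gamma> *v \<delta>) < \<rho>" "matrix_inv \<Sigma> + unvec \<delta> \<in> Sym_pos"
    "\<nu> (R \<delta>) \<le> \<eta> * \<rho> * \<rho> / (1 - \<eta> * \<rho>)"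
    "\<delta> = - (J *v (vec_col (S - \<Sigma>) - R \<delta> + d))"
proof -
  define r where "r = \<eta> * \<rho>"
  have r: "0 < r" "r < 1" using \<eta> \<rho> by (auto simp: r_def)
  define K where "K = matrix_inv \<Sigma>"
  define Q where "Q = \<Gamma> ** J"
  define q where "q = op_norm \<nu> Q"
  have Qle: "\<nu> (Q *v x) \<le> q * \<nu> x" and q0: "0 \<le> q" for x
    using op_norm_bound[OF \<nu>] by (auto simp: q_def)
  have \<Gamma>: "\<Gamma> \<in> Sym_pos" unfolding \<Gamma>_def by (rule kron_Sym_pos[OF \<Sigma>])
  note P = proj_matrix_spec[OF V(1), folded P_def] and P' = proj_matrix_props[OF V(1), folded P_def]
  note J = pinv_compression[OF \<Gamma> P'(2,3), folded J_def]
  have JV: "J *v x \<in> V" for x using P(1)[of "J *v x"] J(3) by (simp add: matrix_vector_mul_assoc)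
  define U where "U = (\<lambda>\<delta>. vec_col (S - \<Sigma>) - R \<delta> + d)"
  define F where "F = (\<lambda>\<delta>. - (J *v U \<delta>))"
  define B where "B = {\<delta> \<in> V. \<nu> (\<Gamma> *v \<delta>) \<le> \<rho>}"
  define T where "T = (\<lambda>\<delta> x. - (kron (\<Sigma> ** unvec \<delta>) (mat 1 :: real^'n^'n) *v x))"
  have sym: "unvec \<delta> \<in> Sym" if "\<delta> \<in> V" for \<delta> using V(2) that by auto
  have op: "op_norm \<nu> (kron (\<Sigma> ** unvec \<delta>) (mat 1 :: real^'n^'n)) \<le> r" if "\<delta> \<in> B" for \<delta>
  proof -
    have "\<eta> * \<nu> (\<Gamma> *v \<delta>) \<le> r"
      unfolding r_def using that \<eta>(1) by (intro mult_left_mono) (auto simp: B_def)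
    then show ?thesis using \<eta>(2)[of \<delta>] that by (simp add: B_def \<Gamma>_def)
  qed
  have pos: "K + unvec \<delta> \<in> Sym_pos" if "\<delta> \<in> B" for \<delta>
    unfolding K_def using op[OF that] r that
    by (intro perturbation_Sym_pos[OF \<nu> \<Sigma> sym]) (auto simp: B_def)
  have Tle: "\<nu> (T \<delta> x) \<le> r * \<nu> x" if "\<delta> \<in> B" for \<delta> x
    using op_norm_bound(1)[OF \<nu>, of "kron (\<Sigma> ** unvec \<delta>) (mat 1)" x]
      mult_right_mono[OF op[OF that] is_normD(1)[OF \<nu>, of x]]
    by (simp add: T_def is_normD(5)[OF \<nu>])
  have Req: "R \<delta> = T \<delta> (- (\<Gamma> *v \<delta>) + R \<delta>)" if "\<delta> \<in> B" for \<delta>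
  proof -
    have "\<delta> \<in> V" using that by (simp add: B_def)
    then show ?thesis
      using inverse_remainder[OF \<Sigma> sym matrix_inv_pos(1)[OF pos[OF that], unfolded K_def]]
      unfolding R_def T_def \<Gamma>_def by (simp only: vec_col_unvec)
  qed
  have Rle: "\<nu> (R \<delta>) \<le> r * \<nu> (\<Gamma> *v \<delta>) / (1 - r)" if "\<delta> \<in> B" for \<delta>
  proof -
    have "\<nu> (R \<delta>) \<le> r * \<nu> (- (\<Gamma> *v \<delta>) + R \<delta>)" using Tle[OF that] Req[OF that] by metis
    also have "\<dots> \<le> r * (\<nu> (\<Gamma> *v \<delta>) + \<nu> (R \<delta>))"
      using is_normD(4)[OF \<nu>, of "- (\<Gamma> *v \<delta>)" "R \<delta>"] is_normD(5)[OF \<nu>, of "\<Gamma> *v \<delta>"] r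
      by (intro mult_left_mono) auto
    finally show ?thesis using r by (simp add: field_simps)
  qed
  define k where "k = r * \<rho> / (1 - r)"
  have Rk: "\<nu> (R \<delta>) \<le> k" if "\<delta> \<in> B" for \<delta>
  proof -
    have "r * \<nu> (\<Gamma> *v \<delta>) / (1 - r) \<le> k"
      unfolding k_def using that r by (intro divide_right_mono mult_left_mono) (auto simp: B_def)
    then show ?thesis using Rle[OF that] by linarith
  qed
  have bound': "q * (\<nu> (vec_col (S - \<Sigma>)) + \<nu> d + k) \<le> \<rho>"
    using bound by (simp add: q_def Q_def k_def r_def)
  have FB: "F \<delta> \<in> B" if "\<delta> \<in> B" for \<delta>
  proof -
    have "F \<delta> \<in> V" unfolding F_def by (rule subspace_neg[OF V(1) JV])
    moreover have "\<nu> (\<Gamma> *v F \<delta>) \<le> \<rho>"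
    proof -
      have "\<nu> (\<Gamma> *v F \<delta>) = \<nu> (Q *v U \<delta>)"
        using linear_neg[OF matrix_vector_mul_linear, of \<Gamma> "J *v U \<delta>"]
        by (simp add: F_def Q_def is_normD(5)[OF \<nu>] matrix_vector_mul_assoc)
      also have "\<dots> \<le> q * \<nu> (U \<delta>)" by (rule Qle)
      also have "\<nu> (U \<delta>) \<le> \<nu> (vec_col (S - \<Sigma>)) + \<nu> d + k"
        using is_normD(4)[OF \<nu>, of "vec_col (S - \<Sigma>) - R \<delta>" d]
          is_normD(6)[OF \<nu>, of "vec_col (S - \<Sigma>)" "R \<delta>"] Rk[OF that]
        unfolding U_def by linarith
      then have "q * \<nu> (U \<delta>) \<le> q * (\<nu> (vec_col (S - \<Sigma>)) + \<nu> d + k)"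
        using q0 by (rule mult_left_mono)
      finally show ?thesis using bound' by linarith
    qed
    ultimately show ?thesis by (simp add: B_def)
  qed
  have \<nu>\<Gamma>: "is_norm (\<lambda>\<delta>. \<nu> (\<Gamma> *v \<delta>))"
  proof -
    have "\<Gamma> *v x = 0 \<longleftrightarrow> x = 0" for x
      using Sym_posD(2)[OF \<Gamma>, of x] by force
    then show ?thesis
      using is_normD[OF \<nu>]
      by (auto simp: is_norm_def matrix_vector_right_distrib matrix_vector_mult_scaleR)
  qed
  have "compact B"
  proof -
    obtain c where c: "0 < c" "\<And>x. c * norm x \<le> \<nu> (\<Gamma> *v x)" using is_norm_lower[OF \<nu>\<Gamma>] by blast
    have "norm x \<le> \<rho> / c" if "x \<in> B" for x
      using c(2)[of x] that c(1) by (auto simp: B_def field_simps)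
    then have "bounded B" by (auto simp: bounded_iff)
    moreover have "closed (V \<inter> {\<delta>. \<nu> (\<Gamma> *v \<delta>) \<le> \<rho>})"
      by (intro closed_Int closed_subspace[OF V(1)] closed_Collect_le
          is_norm_continuous[OF \<nu>\<Gamma>] continuous_on_const)
    ultimately show ?thesis by (simp add: compact_eq_bounded_closed B_def Collect_conj_eq)
  qed
  moreover have "convex B"
  proof (rule convexI)
    fix x y u w assume *: "x \<in> B" "y \<in> B" "(0::real) \<le> u" "0 \<le> w" "u + w = 1"
    have "\<nu> (\<Gamma> *v (u *\<^sub>R x + w *\<^sub>R y)) \<le> u * \<nu> (\<Gamma> *v x) + w * \<nu> (\<Gamma> *v y)"
      using is_normD(4)[OF \<nu>\<Gamma>, of "u *\<^sub>R x" "w *\<^sub>R y"] * by (simp add: is_normD(3)[OF \<nu>\<Gamma>])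
    also have "\<dots> \<le> \<rho>" using * by (intro convex_bound_le) (auto simp: B_def)
    finally show "u *\<^sub>R x + w *\<^sub>R y \<in> B"
      using * V(1) by (auto simp: B_def intro: subspace_add subspace_scale)
  qed
  moreover have "0 \<in> B" using \<rho>(1) subspace_0[OF V(1)] by (simp add: B_def is_normD(7)[OF \<nu>])
  then have "B \<noteq> {}" by blast
  moreover have "continuous_on B F"
  proof -
    have "continuous_on B (\<lambda>\<delta>. matrix_inv (K + unvec \<delta>))"
      using pos matrix_inv_pos(1)
      by (intro continuous_on_matrix_inv continuous_intros linear_continuous_on
          linear_conv_bounded_linear[THEN iffD1, OF linear_unvec]) blast
    then have inv: "continuous_on B (\<lambda>\<delta>. vec_col (matrix_inv (K + unvec \<delta>) - \<Sigma>))"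
      by (intro linear_continuous_on_compose[OF _ linear_vec_col] continuous_intros)
    have "continuous_on B ((*v) \<Gamma>)"
      by (intro linear_continuous_on matrix_vector_mul_bounded_linear)
    with inv have "continuous_on B U"
      unfolding U_def R_def K_def[symmetric] by (intro continuous_intros)
    then show ?thesis
      unfolding F_def
      by (intro continuous_on_minus linear_continuous_on_compose[OF _ matrix_vector_mul_linear])
  qed
  ultimately obtain \<delta> where \<delta>: "\<delta> \<in> B" "F \<delta> = \<delta>"
    using brouwer[of B F] FB by auto
  define y where "y = - (\<Gamma> *v \<delta>)"
  have y: "y = Q *v U \<delta>"
    using \<delta>(2) linear_neg[OF matrix_vector_mul_linear, of \<Gamma> "J *v U \<delta>"]
    by (simp add: y_def F_def Q_def flip: matrix_vector_mul_assoc)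
  have "Q ** Q = Q"
  proof -
    have "J ** \<Gamma> ** J = (J ** P) ** \<Gamma> ** (P ** J)" by (simp add: J)
    also have "\<dots> = J ** (P ** \<Gamma> ** P) ** J" by (simp add: matrix_mul_assoc)
    finally have "J ** \<Gamma> ** J = J" by (simp add: J)
    then show ?thesis by (metis Q_def matrix_mul_assoc)
  qed
  then have Qy: "Q *v y = y" unfolding y by (simp add: matrix_vector_mul_assoc)
  have \<nu>y: "\<nu> y = \<nu> (\<Gamma> *v \<delta>)" by (simp add: y_def is_normD(5)[OF \<nu>])
  have "\<nu> y \<noteq> \<rho>"
  proof
    assume eq: "\<nu> y = \<rho>"
    have "\<nu> y - q * (r * \<nu> y / (1 - r)) < \<nu> (y + Q *v R \<delta>)"
    proof (rule perturbed_projection_norm[OF \<nu>, of "T \<delta>"])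
      show "linear (T \<delta>)" "y \<in> span (range (\<lambda>k. (T \<delta> ^^ Suc k) y))"
        using derivative_in_Krylov_space[OF \<Sigma> sym, of \<delta>] \<delta>(1)
        by (simp_all add: T_def y_def \<Gamma>_def B_def)
      show "R \<delta> = T \<delta> (y + R \<delta>)" unfolding y_def by (rule Req[OF \<delta>(1)])
    qed (use Tle[OF \<delta>(1)] r eq \<rho> Qy Qle in auto)
    also have "y + Q *v R \<delta> = Q *v (vec_col (S - \<Sigma>) + d)"
      unfolding y by (simp add: U_def flip: matrix_vector_right_distrib)
    also have "\<nu> \<dots> \<le> q * \<nu> (vec_col (S - \<Sigma>) + d)" by (rule Qle)
    also have "\<dots> \<le> q * (\<nu> (vec_col (S - \<Sigma>)) + \<nu> d)"
      using q0 is_normD(4)[OF \<nu>] by (intro mult_left_mono) auto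
    finally have "\<rho> < q * (\<nu> (vec_col (S - \<Sigma>)) + \<nu> d) + q * k" by (simp add: eq k_def)
    then show False using bound' by (simp add: algebra_simps)
  qed
  moreover have "\<nu> y \<le> \<rho>" using \<delta>(1) by (simp add: \<nu>y B_def)
  ultimately have "\<nu> (\<Gamma> *v \<delta>) < \<rho>" using \<nu>y by linarith
  moreover have "\<delta> = - (J *v (vec_col (S - \<Sigma>) - R \<delta> + d))"
    using \<delta>(2) by (simp add: F_def U_def)
  moreover have "\<nu> (R \<delta>) \<le> \<eta> * \<rho> * \<rho> / (1 - \<eta> * \<rho>)"
    using Rk[OF \<delta>(1)] by (simp add: k_def r_def)
  ultimately show thesis using that \<delta>(1) pos[OF \<delta>(1)] by (simp add: B_def K_def)
qed

section \<open>Pattern recovery\<close>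

theorem theorem3p3:
  fixes v :: "nat \<Rightarrow> real^('p::{card2,linorder}) lower" and N n :: nat
    and M\<^sub>0 :: "'a measure" and X :: "'a \<Rightarrow> real^('p::{card2,linorder})"
    and M :: "'b measure" and Xs :: "nat \<Rightarrow> 'b \<Rightarrow> real^('p::{card2,linorder})" and \<omega> :: 'b
    and \<Sigma> K Sh :: "'p sqmat"
    and \<Gamma> P \<Gamma>\<^sub>1\<^sub>1 \<Gamma>\<^sub>2\<^sub>1 Q :: "real^('p \<times> 'p)^('p \<times> 'p)"
    and I :: "nat set"
    and \<nu> :: "real^('p \<times> 'p) \<Rightarrow> real"
    and c \<eta> \<alpha> r l :: real
  assumes atoms: "atoms N v"
    and norm: "is_norm \<nu>"
    \<comment> \<open>the model\<close>
    and M\<^sub>0: "prob_space M\<^sub>0"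
    and X: "X \<in> borel_measurable M\<^sub>0"
    and second_moments: "\<And>i. integrable M\<^sub>0 (\<lambda>x. (X x $ i)\<^sup>2)"
    and zero_mean: "\<And>i. (\<integral>x. X x $ i \<partial>M\<^sub>0) = 0"
    and \<Sigma>: "\<Sigma> = cov_matrix M\<^sub>0 X"
    and \<Sigma>_pos: "\<Sigma> \<in> Sym_pos"
    and K: "K = matrix_inv \<Sigma>"
    and M: "prob_space M"
    and n: "1 \<le> n"
    and indep: "prob_space.indep_vars M (\<lambda>_. borel) Xs {1..n}"
    and copies: "\<And>i. i \<in> {1..n} \<Longrightarrow> distr M borel (Xs i) = distr M\<^sub>0 borel X"
    and \<omega>: "\<omega> \<in> space M"
    and Sh: "Sh = sample_cov n (\<lambda>i. Xs i \<omega>)"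
    \<comment> \<open>derived quantities\<close>
    and I: "I = active N v (vec_low K)"
    and \<Gamma>: "\<Gamma> = kron \<Sigma> \<Sigma>"
    and P: "P = proj_matrix (vec_col ` model_space v I)"
    and \<Gamma>\<^sub>1\<^sub>1: "\<Gamma>\<^sub>1\<^sub>1 = P ** \<Gamma> ** P"
    and \<Gamma>\<^sub>2\<^sub>1: "\<Gamma>\<^sub>2\<^sub>1 = (mat 1 - P) ** \<Gamma> ** P"
    and Q: "Q = \<Gamma> ** pinv \<Gamma>\<^sub>1\<^sub>1"
    and c_nonneg: "0 \<le> c"
    and c: "\<And>\<pi>. \<pi> \<in> patt_space v I \<Longrightarrow> \<nu> (dup *v \<pi>) \<le> c * dual_gauge_on N v I \<pi>"
    and \<eta>_pos: "0 < \<eta>"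
    and \<eta>: "\<And>\<Delta>. \<Delta> \<in> model_space v I \<Longrightarrow>
              op_norm \<nu> (kron (\<Sigma> ** \<Delta>) (mat 1 :: 'p sqmat)) \<le> \<eta> * \<nu> (\<Gamma> *v vec_col \<Delta>)"
    \<comment> \<open>the hypotheses proper\<close>
    and tau_defined: "tau_set \<nu> N v I \<noteq> {}"
    and \<alpha>: "0 < \<alpha>" "\<alpha> < 1"
    and irrepresentability:
      "ereal (\<nu> (\<Gamma>\<^sub>2\<^sub>1 *v (pinv \<Gamma>\<^sub>1\<^sub>1 *v (dup *v face_proj v I)))) \<le> ereal (1 - \<alpha>) * tau \<nu> N v I"
    and r: "0 < r" "r < 1"
    and l: "0 < l"
    and r_zeta: "ereal r \<le> ereal \<eta> * zeta \<nu> N v \<Gamma> K"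
    and deviation:
      "ereal (\<nu> (vec_col (Sh - \<Sigma>))) \<le>
         min (ereal (r / (\<eta> * op_norm \<nu> Q) - l * c))
             (ereal (\<alpha> * l) * tau \<nu> N v I / ereal (op_norm \<nu> (mat 1 - Q)))
         - ereal (1 / \<eta> * (r\<^sup>2 / (1 - r)))"
  shows "(\<exists>!Kh. is_arg_min (objective N v l Sh) (\<lambda>L. L \<in> Sym_pos) Kh) \<and>
         (\<forall>Kh. is_arg_min (objective N v l Sh) (\<lambda>L. L \<in> Sym_pos) Kh \<longrightarrow>
            patt_mat N v Kh = patt_mat N v K \<and>
            \<nu> (\<Gamma> *v vec_col (Kh - K)) \<le> r / \<eta>)"
proof -
  have Kpos: "K \<in> Sym_pos" unfolding K by (rule matrix_inv_pos(2)[OF \<Sigma>_pos])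
  have \<Gamma>pos: "\<Gamma> \<in> Sym_pos" unfolding \<Gamma> by (rule kron_Sym_pos[OF \<Sigma>_pos])
  have ShSym: "Sh \<in> Sym"
    by (simp add: Sh sample_cov_def Sym_def transpose_def vec_eq_iff mult.commute)
  define V where "V = vec_col ` model_space v I"
  have V: "subspace V" "V \<subseteq> vec_col ` Sym"
    unfolding V_def
    by (rule linear_subspace_image[OF linear_vec_col subspace_model_space])
      (auto simp: model_space_def)
  define f where "f = face_proj v I"
  define d where "d = l *\<^sub>R (dup *v f)"
  define \<rho> where "\<rho> = r / \<eta>"
  define k where "k = 1 / \<eta> * (r\<^sup>2 / (1 - r))"
  define w where "w = \<nu> (vec_col (Sh - \<Sigma>))"
  define q where "q = op_norm \<nu> Q"
  define q' where "q' = op_norm \<nu> (mat 1 - Q)"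
  define J where "J = pinv \<Gamma>\<^sub>1\<^sub>1"
  have \<rho>: "0 < \<rho>" "\<eta> * \<rho> = r" using r(1) \<eta>_pos by (simp_all add: \<rho>_def)
  have k: "0 < k" "k = \<eta> * \<rho> * \<rho> / (1 - \<eta> * \<rho>)"
    using r \<eta>_pos unfolding \<rho>(2) by (simp_all add: k_def \<rho>_def power2_eq_square)
  have w0: "0 \<le> w" unfolding w_def by (rule is_normD(1)[OF norm])
  have q0: "0 \<le> q" "0 \<le> q'" unfolding q_def q'_def by (rule op_norm_bound(2)[OF norm])+
  obtain i0 where i0: "i0 \<in> I" unfolding I by (rule active_nonempty[OF atoms])
  note f = face_proj[OF i0, where v = v, folded f_def]
  have d: "\<nu> d \<le> l * c"
  proof -
    have "dual_gauge_on N v I f \<le> 1"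
      unfolding f_def I by (rule dual_gauge_on_face_proj[OF atoms i0[unfolded I]])
    then have "c * dual_gauge_on N v I f \<le> c" using c_nonneg mult_left_mono by fastforce
    then have "\<nu> (dup *v f) \<le> c" using c[OF f(1)] by linarith
    then show ?thesis using l by (simp add: d_def is_normD(3)[OF norm])
  qed
  have dev: "w + k \<le> r / (\<eta> * q) - l * c"
    and dev': "ereal (w + k) \<le> ereal (\<alpha> * l) * tau \<nu> N v I / ereal q'"
  proof -
    have split: "w + k \<le> a \<and> ereal (w + k) \<le> B" if "ereal w \<le> min (ereal a) B - ereal k" for a B
      using that by (cases B) (auto simp: min_def split: if_splits)
    show "w + k \<le> r / (\<eta> * q) - l * c" "ereal (w + k) \<le> ereal (\<alpha> * l) * tau \<nu> N v I / ereal q'"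
      using split[OF deviation[folded w_def q_def q'_def k_def]] by auto
  qed
  \<comment> \<open>for \<open>q = 0\<close> the quotient \<open>r / (\<eta> * q)\<close> is \<open>0\<close>, and the deviation bound is violated\<close>
  have qpos: "0 < q"
  proof (rule ccontr)
    assume "\<not> 0 < q"
    then have "w + k \<le> - (l * c)" using dev q0 by simp
    then show False using w0 k(1) mult_nonneg_nonneg[of l c] l c_nonneg by linarith
  qed
  have bound: "q * (w + \<nu> d + k) \<le> \<rho>"
  proof -
    have "w + \<nu> d + k \<le> r / (\<eta> * q)" using dev d by linarith
    then have "q * (w + \<nu> d + k) \<le> q * (r / (\<eta> * q))" using q0 by (intro mult_left_mono)
    then show ?thesis using qpos by (simp add: \<rho>_def)
  qed
  have \<eta>V: "op_norm \<nu> (kron (\<Sigma> ** unvec \<delta>) (mat 1 :: 'p sqmat)) \<le> \<eta> * \<nu> (kron \<Sigma> \<Sigma> *v \<delta>)"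
    if \<delta>: "\<delta> \<in> V" for \<delta>
  proof -
    obtain \<Delta> where "\<Delta> \<in> model_space v I" "\<delta> = vec_col \<Delta>" using \<delta> by (auto simp: V_def)
    then show ?thesis using \<eta>[of \<Delta>] by (simp add: \<Gamma>)
  qed
  have Jeq: "pinv (proj_matrix V ** kron \<Sigma> \<Sigma> ** proj_matrix V) = J"
    by (simp add: J_def \<Gamma>\<^sub>1\<^sub>1 P \<Gamma> V_def)
  have QJ: "Q = \<Gamma> ** J" by (simp add: Q J_def)
  have bound': "op_norm \<nu> (kron \<Sigma> \<Sigma> ** pinv (proj_matrix V ** kron \<Sigma> \<Sigma> ** proj_matrix V)) *
      (\<nu> (vec_col (Sh - \<Sigma>)) + \<nu> d + \<eta> * \<rho> * \<rho> / (1 - \<eta> * \<rho>)) \<le> \<rho>"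
    unfolding Jeq using bound by (simp only: q_def w_def k(2) QJ \<Gamma>)
  have lt1: "\<eta> * \<rho> < 1" using \<rho> r by simp
  note sol = restricted_stationary_point[OF norm \<Sigma>_pos V \<eta>_pos \<eta>V \<rho>(1) lt1 bound',
      unfolded Jeq, folded \<Gamma> K k(2)]
  obtain \<delta> where \<delta>V: "\<delta> \<in> V" and \<delta>\<rho>: "\<nu> (\<Gamma> *v \<delta>) < \<rho>" and pos: "K + unvec \<delta> \<in> Sym_pos"
    and Rk: "\<nu> (vec_col (matrix_inv (K + unvec \<delta>) - \<Sigma>) + \<Gamma> *v \<delta>) \<le> k"
    and fp: "\<delta> = - (J *v (vec_col (Sh - \<Sigma>)
          - (vec_col (matrix_inv (K + unvec \<delta>) - \<Sigma>) + \<Gamma> *v \<delta>) + d))"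
    by (rule sol, assumption, rule that)
  define Kh where "Kh = K + unvec \<delta>"
  define R where "R = vec_col (matrix_inv Kh - \<Sigma>) + \<Gamma> *v \<delta>"
  define W where "W = vec_col (Sh - \<Sigma>)"
  have fp': "\<delta> = - (J *v (W - R + d))" using fp by (simp add: W_def R_def Kh_def)
  note P = P[folded V_def]
  note P' = proj_matrix_props[OF V(1), folded P]
  note J' = pinv_compression[OF \<Gamma>pos P'(2,3), folded \<Gamma>\<^sub>1\<^sub>1 J_def]
  have KM: "K \<in> model_space v I"
    using Kpos active_patt_space by (auto simp: model_space_def I Sym_pos_def)
  have \<Delta>M: "unvec \<delta> \<in> model_space v I" using \<delta>V by (auto simp: V_def)
  have KhM: "Kh \<in> model_space v I"
    unfolding Kh_def by (rule subspace_add[OF subspace_model_space KM \<Delta>M])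
  have \<Delta>: "vec_col (Kh - K) = \<delta>" by (simp add: Kh_def)
  \<comment> \<open>this is where the strict inequality \<open>\<delta>\<rho>\<close> is needed\<close>
  have patt: "patt_mat N v Kh = patt_mat N v K"
    by (rule zeta_patt_eq[OF \<eta>_pos r_zeta]) (use KhM \<delta>\<rho> in \<open>simp_all add: I \<Delta> \<rho>_def\<close>)
  define Z where "Z = Sh - matrix_inv Kh + l *\<^sub>R sym_of_low f"
  have Z1: "vec_col Z = vec_col (Sh - matrix_inv Kh) + d"
    by (simp add: Z_def d_def dup_vec vec_col_add vec_col_scaleR)
  have Z2: "vec_col Z = (W - R + d) + \<Gamma> *v \<delta>"
    unfolding Z1 by (simp add: W_def R_def vec_col_diff)
  have \<Gamma>\<delta>: "\<Gamma> *v \<delta> = - (Q *v (W - R + d))"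
    by (subst fp') (simp add: QJ linear_neg[OF matrix_vector_mul_linear] matrix_vector_mul_assoc)
  have ZQ: "vec_col Z = (mat 1 - Q) *v (W - R) + (mat 1 - Q) *v d"
    unfolding Z2 \<Gamma>\<delta> by (simp add: algebra_simps)
  have "P *v vec_col Z = 0"
  proof -
    have "P *v (\<Gamma> *v \<delta>) = P *v (\<Gamma> *v (P *v \<delta>))" using P'(1)[OF \<delta>V] by simp
    also have "\<dots> = \<Gamma>\<^sub>1\<^sub>1 *v \<delta>" by (simp add: \<Gamma>\<^sub>1\<^sub>1 flip: matrix_vector_mul_assoc)
    also have "\<dots> = - (P *v (W - R + d))"
      by (subst fp') (simp add: linear_neg[OF matrix_vector_mul_linear] matrix_vector_mul_assoc J')
    finally show ?thesis unfolding Z2 by (simp add: matrix_vector_right_distrib)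
  qed
  then have Zort: "vec_col Z \<in> orthogonal_comp (vec_col ` model_space v I)"
    using P'(4) by (simp add: V_def)
  have ZSym: "Z \<in> Sym"
    using ShSym matrix_inv_pos(2)[OF pos] sym_of_low(1)[of f]
    by (simp add: Z_def Kh_def Sym_def Sym_zero_def Sym_pos_def transpose_add transpose_diff
        transpose_scalar)
  obtain \<pi>' where \<pi>': "\<pi>' \<in> orthogonal_comp (patt_space v I)" "vec_col Z = dup *v \<pi>'"
    using model_space_orthogonal_comp[OF ZSym Zort] .
  define \<pi> where "\<pi> = (- 1 / l) *\<^sub>R \<pi>'"
  have \<pi>: "\<pi> \<in> orthogonal_comp (patt_space v I)"
    unfolding \<pi>_def by (rule subspace_scale[OF subspace_orthogonal_comp \<pi>'(1)])
  have dup\<pi>: "dup *v \<pi> = (- 1 / l) *\<^sub>R vec_col Z"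
    unfolding \<pi>_def \<pi>'(2) by (rule matrix_vector_mult_scaleR)
  define t where "t = \<nu> (\<Gamma>\<^sub>2\<^sub>1 *v (J *v (dup *v f)))"
  \<comment> \<open>\<open>\<Gamma>\<^sub>2\<^sub>1 J = Q - P\<close> turns the irrepresentability term into the part of \<open>Z\<close> that comes from the penalty\<close>
  have Zle: "\<nu> (vec_col Z) \<le> q' * (w + k) + l * t"
  proof -
    have dupf: "dup *v f \<in> V"
      unfolding V_def dup_vec by (intro imageI sym_of_low_model_space f(1))
    have "\<Gamma>\<^sub>2\<^sub>1 ** J = \<Gamma> ** (P ** J) - \<Gamma>\<^sub>1\<^sub>1 ** J"
      by (simp add: \<Gamma>\<^sub>2\<^sub>1 \<Gamma>\<^sub>1\<^sub>1 matrix_diff_rdistrib matrix_mul_assoc)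
    also have "\<dots> = Q - P" by (simp add: J' QJ)
    finally have e: "\<Gamma>\<^sub>2\<^sub>1 ** J = Q - P" .
    have "\<Gamma>\<^sub>2\<^sub>1 *v (J *v (dup *v f)) = Q *v (dup *v f) - dup *v f"
      using P'(1)[OF dupf]
      by (simp add: e matrix_vector_mul_assoc[of \<Gamma>\<^sub>2\<^sub>1 J] matrix_vector_mult_diff_rdistrib)
    then have "(mat 1 - Q) *v d = - (l *\<^sub>R (\<Gamma>\<^sub>2\<^sub>1 *v (J *v (dup *v f))))"
      by (simp add: d_def matrix_vector_mult_scaleR matrix_vector_mult_diff_rdistrib
          scaleR_diff_right)
    then have 1: "\<nu> ((mat 1 - Q) *v d) = l * t"
      using l by (simp add: is_normD(3,5)[OF norm] t_def)
    have "\<nu> ((mat 1 - Q) *v (W - R)) \<le> q' * \<nu> (W - R)"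
      unfolding q'_def by (rule op_norm_bound(1)[OF norm])
    also have "\<nu> (W - R) \<le> w + k"
      using is_normD(6)[OF norm, of W R] Rk unfolding w_def W_def R_def Kh_def by linarith
    then have "q' * \<nu> (W - R) \<le> q' * (w + k)" using q0(2) by (rule mult_left_mono)
    finally have 2: "\<nu> ((mat 1 - Q) *v (W - R)) \<le> q' * (w + k)" .
    have "\<nu> (vec_col Z) \<le> \<nu> ((mat 1 - Q) *v (W - R)) + \<nu> ((mat 1 - Q) *v d)"
      unfolding ZQ by (rule is_normD(4)[OF norm])
    then show ?thesis using 1 2 by linarith
  qed
  have tau_le: "ereal (\<nu> (dup *v \<pi>)) \<le> tau \<nu> N v I"
  proof (cases "tau \<nu> N v I")
    case (real T)
    \<comment> \<open>for \<open>q' = 0\<close> the quotient in \<open>dev'\<close> is infinite or zero, and only \<open>0 \<le> T\<close> is needed\<close>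
    have "q' * (w + k) \<le> \<alpha> * l * T"
    proof (cases "q' = 0")
      case True
      obtain s where "s \<in> tau_set \<nu> N v I" using tau_defined by blast
      then have "ereal 0 \<le> ereal s" "ereal s \<le> tau \<nu> N v I"
        by (auto simp: tau_set_def tau_def intro: Sup_upper)
      then have "0 \<le> T" using real by (metis ereal_less_eq(3) order.trans)
      then show ?thesis using True \<alpha> l by simp
    next
      case False
      then have "w + k \<le> \<alpha> * l * T / q'" using dev' real by simp
      then show ?thesis using False q0(2) by (simp add: field_simps)
    qed
    moreover have "l * t \<le> l * ((1 - \<alpha>) * T)"
      using irrepresentability l by (simp add: real t_def J_def f_def)
    ultimately have "\<nu> (vec_col Z) \<le> l * T" using Zle by (simp add: algebra_simps)
    then show ?thesis
      using l by (simp add: real dup\<pi> is_normD(3,5)[OF norm] field_simps)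
  next
    case MInf
    obtain s where "s \<in> tau_set \<nu> N v I" using tau_defined by blast
    then have "ereal s \<le> tau \<nu> N v I" by (auto simp: tau_def intro: Sup_upper)
    then show ?thesis using MInf by simp
  qed simp
  define g where "g = f + \<pi>"
  have g: "g \<bullet> x \<le> atomic_norm N v x" for x
    unfolding g_def f_def by (rule tau_dual_gauge[OF atoms norm tau_defined \<pi> tau_le])
  have gKh: "g \<bullet> vec_low Kh = atomic_norm N v (vec_low Kh)"
  proof -
    have S: "vec_low Kh \<in> patt_space v I" using KhM by (simp add: model_space_def)
    then have "\<pi> \<bullet> vec_low Kh = 0"
      using \<pi> by (auto simp: orthogonal_comp_def orthogonal_def inner_commute)
    moreover have "v i0 \<bullet> vec_low Kh = atomic_norm N v (vec_low Kh)"
      using active_if_patt_eq[OF patt[unfolded patt_mat_def]] i0 by (simp add: I)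
    ultimately show ?thesis using f(2)[OF S] by (simp add: g_def inner_add_left)
  qed
  have stat: "vec_col (Sh - matrix_inv Kh) + l *\<^sub>R (dup *v g) = 0"
  proof -
    have "l *\<^sub>R (dup *v g) = d - vec_col Z"
      using l by (simp add: g_def matrix_vector_right_distrib dup\<pi> scaleR_diff_right d_def)
    then show ?thesis using Z1 by simp
  qed
  have less: "objective N v l Sh Kh < objective N v l Sh L" if "L \<in> Sym_pos" "L \<noteq> Kh" for L
    using objective_less[OF pos[folded Kh_def] that ShSym _ g gKh stat] l by simp
  have min: "is_arg_min (objective N v l Sh) (\<lambda>L. L \<in> Sym_pos) L \<longleftrightarrow> L = Kh" for L
    using less pos[folded Kh_def] unfolding is_arg_min_def by (metis less_asym)
  show ?thesis
    unfolding min using patt \<delta>\<rho> by (simp add: \<Delta> \<rho>_def)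
qed
end
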